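(* Let $1\le k\le d$ be integers. Every finite strongly connected pure $d$-dimensional simplicial complex $X$ with $H_k(X)\neq 0$ has at least $d+1+\left\lceil \frac{d}{k}\right\rceil=\left\lceil \frac{d(k+1)}{k}+1\right\rceil$ vertices. Moreover, this bound is tight: there exists a strongly connected pure $d$-dimensional simplicial complex with nontrivial $H_k$ having exactly $d+1+\left\lceil \frac{d}{k}\right\rceil$ vertices.
   Context: A simplicial complex is pure $d$-dimensional if every simplex is contained in a $d$-dimensional face. On the set of $d$-dimensional faces, let $\sim'$ be the equivalence relation generated by declaring $\sigma\sim\tau$ when $\sigma$ and $\tau$ share a $(d-1)$-dimensional face. A pure $d$-dimensional complex is strongly connected if all its $d$-dimensional faces lie in a single $\sim'$-equivalence class. Homology is simplicial homology with coefficients in an arbitrary abelian group. *)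

theory Defs
  imports "HOL-Algebra.Elementary_Groups" "HOL-Combinatorics.Permutations" Complex_Main
begin

section \<open>Abstract simplicial complexes\<close>

text \<open>Simplices are nonempty finite vertex sets; a simplex of dimension \<open>n\<close> has \<open>n + 1\<close> elements.\<close>

definition abstract_simplicial_complex :: "'a set set \<Rightarrow> bool" where
  "abstract_simplicial_complex X \<longleftrightarrow>
     (\<forall>\<sigma>\<in>X. finite \<sigma> \<and> \<sigma> \<noteq> {}) \<and> (\<forall>\<sigma>\<in>X. \<forall>\<tau>. \<tau> \<subseteq> \<sigma> \<and> \<tau> \<noteq> {} \<longrightarrow> \<tau> \<in> X)"

definition vertices :: "'a set set \<Rightarrow> 'a set" where
  "vertices X = {v. {v} \<in> X}"

definition faces :: "nat \<Rightarrow> 'a set set \<Rightarrow> 'a set set" where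
  "faces n X = {\<sigma> \<in> X. card \<sigma> = n + 1}"

definition pure_complex :: "nat \<Rightarrow> 'a set set \<Rightarrow> bool" where
  "pure_complex d X \<longleftrightarrow> (\<forall>\<sigma>\<in>X. \<exists>\<tau>\<in>faces d X. \<sigma> \<subseteq> \<tau>)"

text \<open>Only meant for \<open>d \<ge> 1\<close>.\<close>

definition adjacent_facets :: "nat \<Rightarrow> 'a set set \<Rightarrow> 'a set \<Rightarrow> 'a set \<Rightarrow> bool" where
  "adjacent_facets d X \<sigma> \<tau> \<longleftrightarrow>
     \<sigma> \<in> faces d X \<and> \<tau> \<in> faces d X \<and> (\<exists>\<rho>\<in>faces (d - 1) X. \<rho> \<subseteq> \<sigma> \<and> \<rho> \<subseteq> \<tau>)"

definition strongly_connected_complex :: "nat \<Rightarrow> 'a set set \<Rightarrow> bool" where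
  "strongly_connected_complex d X \<longleftrightarrow>
     pure_complex d X \<and>
     (\<forall>\<sigma>\<in>faces d X. \<forall>\<tau>\<in>faces d X. equivclp (adjacent_facets d X) \<sigma> \<tau>)"


section \<open>Simplicial homology with coefficients in an abelian group\<close>

text \<open>
  The list \<open>[v\<^sub>0, \<dots>, v\<^sub>k]\<close> stands for the oriented simplex with this ordering of its vertices.
  A \<open>k\<close>-chain is a finitely supported function on oriented \<open>k\<close>-simplices that changes sign
  under odd permutations of the vertices.  No ordering of the vertex type is needed.
\<close>

definition oriented_simplices :: "nat \<Rightarrow> 'a set set \<Rightarrow> 'a list set" where
  "oriented_simplices k X = {s. distinct s \<and> set s \<in> faces k X}"

definition simplicial_chains :: "nat \<Rightarrow> 'a set set \<Rightarrow> ('a list \<Rightarrow> 'g::ab_group_add) set" where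
  "simplicial_chains k X = {c.
     finite {s. c s \<noteq> 0} \<and>
     (\<forall>s. s \<notin> oriented_simplices k X \<longrightarrow> c s = 0) \<and>
     (\<forall>s p. p permutes {..<length s} \<longrightarrow>
        c (permute_list p s) = (if evenperm p then c s else - c s))}"

text \<open>
  Writing \<open>s\<close> for \<open>[v\<^sub>0, \<dots>, v\<^sub>k]\<close> with \<open>v\<^sub>i\<close> omitted, \<open>v\<^sub>i # s\<close> differs from \<open>[v\<^sub>0, \<dots>, v\<^sub>k]\<close> by a
  permutation of sign \<open>(-1)^i\<close>, so the coefficient of \<open>s\<close> in the usual alternating sum is
  obtained by summing the values of the chain over all \<open>v # s\<close>.  There are no chains in degree
  \<open>-1\<close> (unreduced homology), whence the value \<open>0\<close> at the empty list.
\<close>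

definition simplicial_boundary :: "('a list \<Rightarrow> 'g::ab_group_add) \<Rightarrow> 'a list \<Rightarrow> 'g" where
  "simplicial_boundary c = (\<lambda>s. if s = [] then 0 else (\<Sum>v | c (v # s) \<noteq> 0. c (v # s)))"

definition simplicial_cycles :: "nat \<Rightarrow> 'a set set \<Rightarrow> ('a list \<Rightarrow> 'g::ab_group_add) set" where
  "simplicial_cycles k X = {c \<in> simplicial_chains k X. simplicial_boundary c = (\<lambda>_. 0)}"

definition simplicial_boundaries :: "nat \<Rightarrow> 'a set set \<Rightarrow> ('a list \<Rightarrow> 'g::ab_group_add) set" where
  "simplicial_boundaries k X = simplicial_boundary ` simplicial_chains (Suc k) X"

definition simplicial_cycle_group :: "nat \<Rightarrow> 'a set set \<Rightarrow> ('a list \<Rightarrow> 'g::ab_group_add) monoid" where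
  "simplicial_cycle_group k X = \<lparr>carrier = simplicial_cycles k X, monoid.mult = (\<lambda>a b s. a s + b s), monoid.one = (\<lambda>_. 0)\<rparr>"

definition simplicial_homology ::
    "nat \<Rightarrow> 'a set set \<Rightarrow> ('a list \<Rightarrow> 'g::ab_group_add) set monoid" where
  "simplicial_homology k X = simplicial_cycle_group k X Mod simplicial_boundaries k X"


subsection \<open>The homology groups are well defined\<close>

lemma chains_finite: "c \<in> simplicial_chains k X \<Longrightarrow> finite {v. c (v # s) \<noteq> 0}"
proof -
  assume "c \<in> simplicial_chains k X"
  then have "finite {s. c s \<noteq> 0}" by (simp add: simplicial_chains_def)
  then have "finite ((\<lambda>v. v # s) -` {s. c s \<noteq> 0})"
    by (rule finite_vimageI) (simp add: inj_def)
  then show ?thesis by (simp add: vimage_def)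
qed

lemma boundary_eq_sum:
  assumes "finite V" "{v. c (v # s) \<noteq> 0} \<subseteq> V" "s \<noteq> []"
  shows "simplicial_boundary c s = (\<Sum>v\<in>V. c (v # s))"
  unfolding simplicial_boundary_def using assms by (auto intro!: sum.mono_neutral_left)

lemma boundary_nonzero:
  assumes "simplicial_boundary c s \<noteq> 0"
  shows "s \<noteq> [] \<and> (\<exists>v. c (v # s) \<noteq> 0)"
proof (rule ccontr)
  assume "\<not> ?thesis"
  then have "simplicial_boundary c s = 0" by (auto simp: simplicial_boundary_def)
  with assms show False by simp
qed

lemma chains_zero: "(\<lambda>_. 0) \<in> simplicial_chains k X"
  by (simp add: simplicial_chains_def)

lemma chains_add:
  assumes "a \<in> simplicial_chains k X" "b \<in> simplicial_chains k X"
  shows "(\<lambda>s. a s + b s) \<in> simplicial_chains k X"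
proof -
  have "finite ({s. a s \<noteq> 0} \<union> {s. b s \<noteq> 0})" using assms by (simp add: simplicial_chains_def)
  then have "finite {s. a s + b s \<noteq> 0}" by (rule rev_finite_subset) auto
  then show ?thesis using assms by (simp add: simplicial_chains_def)
qed

lemma chains_minus: "a \<in> simplicial_chains k X \<Longrightarrow> (\<lambda>s. - a s) \<in> simplicial_chains k X"
  by (simp add: simplicial_chains_def)

lemma boundary_zero: "simplicial_boundary (\<lambda>_. 0) = (\<lambda>_. 0)"
  by (auto simp: simplicial_boundary_def)

lemma boundary_add:
  assumes "a \<in> simplicial_chains k X" "b \<in> simplicial_chains k X"
  shows "simplicial_boundary (\<lambda>s. a s + b s) = (\<lambda>s. simplicial_boundary a s + simplicial_boundary b s)"
proof
  fix s
  let ?V = "{v. a (v # s) \<noteq> 0} \<union> {v. b (v # s) \<noteq> 0}"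
  have V: "finite ?V" using assms chains_finite by blast
  show "simplicial_boundary (\<lambda>s. a s + b s) s = simplicial_boundary a s + simplicial_boundary b s"
  proof (cases "s = []")
    case False
    have "simplicial_boundary (\<lambda>s. a s + b s) s = (\<Sum>v\<in>?V. a (v # s) + b (v # s))"
      using V False by (intro boundary_eq_sum) auto
    moreover have "simplicial_boundary a s = (\<Sum>v\<in>?V. a (v # s))"
      using V False by (intro boundary_eq_sum) auto
    moreover have "simplicial_boundary b s = (\<Sum>v\<in>?V. b (v # s))"
      using V False by (intro boundary_eq_sum) auto
    ultimately show ?thesis by (simp add: sum.distrib)
  qed (simp add: simplicial_boundary_def)
qed

lemma boundary_minus: "simplicial_boundary (\<lambda>s. - a s) = (\<lambda>s. - simplicial_boundary a s)"
  by (auto simp: simplicial_boundary_def sum_negf)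

lemma chains_perm_Cons:
  assumes c: "c \<in> simplicial_chains k X" and p: "p permutes {..<length s}"
  shows "c (v # permute_list p s) = (if evenperm p then c (v # s) else - c (v # s))"
proof -
  let ?q = "map_permutation {..<length s} Suc p"
  have inj: "inj_on Suc {..<length s}" by simp
  have q: "?q permutes Suc ` {..<length s}"
    using p inj by (intro map_permutation_permutes) (auto simp: bij_betw_def)
  then have q': "?q permutes {..<length (v # s)}"
    by (rule permutes_subset) auto
  have q0: "?q 0 = 0" using q by (auto simp: permutes_def)
  have qS: "?q (Suc i) = Suc (p i)" if "i < length s" for i
    using that inj by (simp add: map_permutation_apply)
  have "permute_list ?q (v # s) = v # permute_list p s"
    by (rule nth_equalityI)
       (auto simp: permute_list_def q0 qS nth_Cons' less_Suc_eq_0_disj simp del: upt_Suc)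
  moreover have "evenperm ?q = evenperm p"
    using p inj by (intro evenperm_map_permutation) auto
  moreover have "c (permute_list ?q (v # s)) = (if evenperm ?q then c (v # s) else - c (v # s))"
    using c q' unfolding simplicial_chains_def by blast
  ultimately show ?thesis by simp
qed

lemma boundary_in_chains:
  assumes X: "abstract_simplicial_complex X" and c: "c \<in> simplicial_chains (Suc k) X"
  shows "simplicial_boundary c \<in> simplicial_chains k X"
proof -
  have "finite (tl ` {s. c s \<noteq> 0})" using c by (simp add: simplicial_chains_def)
  moreover have "{s. simplicial_boundary c s \<noteq> 0} \<subseteq> tl ` {s. c s \<noteq> 0}"
  proof clarify
    fix s assume "simplicial_boundary c s \<noteq> 0"
    then obtain v where "c (v # s) \<noteq> 0" by (blast dest: boundary_nonzero)
    then show "s \<in> tl ` {s. c s \<noteq> 0}" by (intro image_eqI[of _ _ "v # s"]) auto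
  qed
  ultimately have fin: "finite {s. simplicial_boundary c s \<noteq> 0}" by (rule rev_finite_subset)
  have supp: "s \<in> oriented_simplices k X" if s: "simplicial_boundary c s \<noteq> 0" for s
  proof -
    obtain v where v: "s \<noteq> []" "c (v # s) \<noteq> 0"
      using s by (blast dest: boundary_nonzero)
    then have "v # s \<in> oriented_simplices (Suc k) X" using c by (auto simp: simplicial_chains_def)
    then have *: "distinct (v # s)" "set (v # s) \<in> X" "card (set (v # s)) = Suc (Suc k)"
      by (auto simp: oriented_simplices_def faces_def)
    have "set s \<in> X" using X *(2) v(1) unfolding abstract_simplicial_complex_def
      by (metis set_empty set_subset_Cons)
    then show ?thesis using * by (simp add: oriented_simplices_def faces_def)
  qed
  have perm: "simplicial_boundary c (permute_list p s) = (if evenperm p then simplicial_boundary c s else - simplicial_boundary c s)"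
    if p: "p permutes {..<length s}" for s p
  proof (cases "s = []")
    case False
    then have "permute_list p s \<noteq> []" by (metis length_0_conv length_permute_list)
    then show ?thesis using False chains_perm_Cons[OF c p] by (simp add: simplicial_boundary_def sum_negf)
  qed (simp add: simplicial_boundary_def)
  show ?thesis using fin supp perm unfolding simplicial_chains_def by auto
qed

lemma sum_antisym_zero:
  fixes f :: "'b \<Rightarrow> 'b \<Rightarrow> 'g::ab_group_add"
  assumes "finite V" "\<And>v w. f v w = - f w v" "\<And>v. f v v = 0"
  shows "(\<Sum>v\<in>V. \<Sum>w\<in>V. f v w) = 0"
  using assms(1)
proof (induction V rule: finite_induct)
  case (insert x V)
  have "(\<Sum>v\<in>V. f v x) = (\<Sum>v\<in>V. - f x v)" by (intro sum.cong refl assms(2))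
  then show ?case using insert by (simp add: assms(3) sum.distrib sum_negf)
qed simp

lemma boundary_boundary:
  assumes c: "c \<in> simplicial_chains k X"
  shows "simplicial_boundary (simplicial_boundary c) = (\<lambda>_. 0)"
proof
  fix s
  show "simplicial_boundary (simplicial_boundary c) s = 0"
  proof (cases "s = []")
    case False
    let ?V = "\<Union>t\<in>{t. c t \<noteq> 0}. set t"
    have V: "finite ?V" using c by (simp add: simplicial_chains_def)
    have b: "simplicial_boundary c (v # s) = (\<Sum>w\<in>?V. c (w # v # s))" for v
      by (rule boundary_eq_sum[OF V]) force+
    have "{v. simplicial_boundary c (v # s) \<noteq> 0} \<subseteq> ?V"
    proof clarify
      fix v assume "simplicial_boundary c (v # s) \<noteq> 0"
      then obtain w where "c (w # v # s) \<noteq> 0"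
        by (blast dest: boundary_nonzero)
      then show "v \<in> ?V" by force
    qed
    then have "simplicial_boundary (simplicial_boundary c) s = (\<Sum>v\<in>?V. \<Sum>w\<in>?V. c (w # v # s))"
      using False by (subst boundary_eq_sum[OF V]) (auto simp: b)
    also have "\<dots> = 0"
    proof (rule sum_antisym_zero[OF V])
      fix v w
      let ?p = "Transposition.transpose 0 (1::nat)"
      have "?p permutes {..<length (v # w # s)}" by (rule permutes_swap_id) auto
      then have "c (permute_list ?p (v # w # s)) = - c (v # w # s)"
        using c by (simp add: simplicial_chains_def evenperm_swap)
      moreover have "permute_list ?p (v # w # s) = w # v # s"
        by (rule nth_equalityI)
           (auto simp: permute_list_def nth_Cons' less_Suc_eq_0_disj Transposition.transpose_def
                 simp del: upt_Suc)
      ultimately show "c (w # v # s) = - c (v # w # s)" by simp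
    next
      fix v show "c (v # v # s) = 0" using c by (auto simp: simplicial_chains_def oriented_simplices_def)
    qed
    finally show ?thesis .
  qed (simp add: simplicial_boundary_def)
qed

lemma comm_group_cycle_group:
  "comm_group (simplicial_cycle_group k X :: ('a list \<Rightarrow> 'g::ab_group_add) monoid)"
proof (rule comm_groupI)
  fix a :: "'a list \<Rightarrow> 'g" assume "a \<in> carrier (simplicial_cycle_group k X)"
  then have "(\<lambda>s. - a s) \<in> carrier (simplicial_cycle_group k X)"
    by (simp add: simplicial_cycle_group_def simplicial_cycles_def chains_minus boundary_minus fun_eq_iff)
  then show "\<exists>b\<in>carrier (simplicial_cycle_group k X). b \<otimes>\<^bsub>simplicial_cycle_group k X\<^esub> a = \<one>\<^bsub>simplicial_cycle_group k X\<^esub>"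
    by (rule rev_bexI) (simp add: simplicial_cycle_group_def)
qed (auto simp: simplicial_cycle_group_def simplicial_cycles_def chains_add boundary_add chains_zero boundary_zero
      algebra_simps)

lemma normal_boundaries:
  assumes X: "abstract_simplicial_complex X"
  shows "(simplicial_boundaries k X :: ('a list \<Rightarrow> 'g::ab_group_add) set) \<lhd> simplicial_cycle_group k X"
proof -
  interpret comm_group "simplicial_cycle_group k X :: ('a list \<Rightarrow> 'g) monoid"
    by (rule comm_group_cycle_group)
  have sub: "(simplicial_boundaries k X :: ('a list \<Rightarrow> 'g) set) \<subseteq> carrier (simplicial_cycle_group k X)"
    using boundary_in_chains[OF X] boundary_boundary
    by (fastforce simp: simplicial_boundaries_def simplicial_cycle_group_def simplicial_cycles_def)
  have "subgroup (simplicial_boundaries k X :: ('a list \<Rightarrow> 'g) set) (simplicial_cycle_group k X)"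
  proof (rule subgroupI[OF sub])
    show "(simplicial_boundaries k X :: ('a list \<Rightarrow> 'g) set) \<noteq> {}" using chains_zero by (auto simp: simplicial_boundaries_def)
  next
    fix a :: "'a list \<Rightarrow> 'g" assume a: "a \<in> simplicial_boundaries k X"
    then obtain c where c: "c \<in> simplicial_chains (Suc k) X" "a = simplicial_boundary c" by (auto simp: simplicial_boundaries_def)
    have m: "(\<lambda>s. - a s) \<in> simplicial_boundaries k X"
      unfolding simplicial_boundaries_def by (rule image_eqI[OF _ chains_minus[OF c(1)]]) (simp add: c boundary_minus)
    have "inv\<^bsub>simplicial_cycle_group k X\<^esub> a = (\<lambda>s. - a s)"
      by (rule inv_equality) (use a m sub in \<open>auto simp: simplicial_cycle_group_def\<close>)
    with m show "inv\<^bsub>simplicial_cycle_group k X\<^esub> a \<in> simplicial_boundaries k X" by simp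
  next
    fix a b :: "'a list \<Rightarrow> 'g" assume "a \<in> simplicial_boundaries k X" "b \<in> simplicial_boundaries k X"
    then obtain c e where c: "c \<in> simplicial_chains (Suc k) X" "a = simplicial_boundary c"
      and e: "e \<in> simplicial_chains (Suc k) X" "b = simplicial_boundary e" by (auto simp: simplicial_boundaries_def)
    show "a \<otimes>\<^bsub>simplicial_cycle_group k X\<^esub> b \<in> simplicial_boundaries k X"
      unfolding simplicial_boundaries_def
      by (rule image_eqI[OF _ chains_add[OF c(1) e(1)]])
         (simp add: c e boundary_add[OF c(1) e(1)] simplicial_cycle_group_def)
  qed
  then show ?thesis by (rule subgroup_imp_normal)
qed

lemma group_simplicial_homology:
  "abstract_simplicial_complex X \<Longrightarrow> group (simplicial_homology k X)"
  unfolding simplicial_homology_def by (rule normal.factorgroup_is_group[OF normal_boundaries])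

end

(*
  Lower bound. Suppose X has d + 1 + r vertices with r k < d. Every facet omits r vertices, so a
  ridge (d vertices) shared by two adjacent facets meets the intersection of any k further facets.
  Build X by adding the facets one at a time, each adjacent to an earlier one. The new facet y
  meets the part already built in the union of the simplices f \<inter> y. One of them, coming from the
  neighbour of y, meets every intersection of at most k others, so by induction this union has no
  reduced homology in degree k - 1, and Mayer-Vietoris shows that no homology appears in degree k.

  Tightness. Colour d + r + 1 vertices with k + 2 colours, one of them used only once and every
  colour at most r times, and let the facets be the sets of d + 1 vertices that miss some colour.
  The colouring maps this complex to the boundary of the (k + 1)-simplex, and it maps the boundary
  of a rainbow simplex to the fundamental cycle.
*)

theory Submission
  imports Defs
begin

section \<open>Alternating chains\<close>

text \<open>Only adjacent transpositions are required, since they generate all permutations. A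
  repeated vertex merely makes twice the value vanish, so distinctness is imposed separately in
  \<open>alt_chains\<close>.\<close>

definition alternating :: "('a list \<Rightarrow> 'g::ab_group_add) \<Rightarrow> bool" where
  "alternating c \<longleftrightarrow> (\<forall>xs a b ys. c (xs @ a # b # ys) = - c (xs @ b # a # ys))"

text \<open>The index \<open>n\<close> counts vertices, so the degree is \<open>n - 1\<close>, and
  \<open>n = 0\<close> is allowed: when \<open>{} \<in> K\<close> this is the augmented complex,
  which computes reduced homology.\<close>

definition alt_chains :: "nat \<Rightarrow> 'a set set \<Rightarrow> ('a list \<Rightarrow> 'g::ab_group_add) set" where
  "alt_chains n K = {c. alternating c \<and> (\<forall>s. c s \<noteq> 0 \<longrightarrow> distinct s \<and> length s = n \<and> set s \<in> K)}"

text \<open>Summing over a fixed \<open>V\<close> instead of the support makes additivity immediate.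
  At the empty list the value is the augmentation, where \<open>simplicial_boundary\<close> has
  0.\<close>

definition bd :: "'a set \<Rightarrow> ('a list \<Rightarrow> 'g::ab_group_add) \<Rightarrow> 'a list \<Rightarrow> 'g" where
  "bd V c s = (\<Sum>v\<in>V. c (v # s))"

lemma alternatingD: "alternating c \<Longrightarrow> c (xs @ a # b # ys) = - c (xs @ b # a # ys)"
  unfolding alternating_def by blast

lemma alternating_Cons:
  assumes "alternating c" shows "alternating (\<lambda>t. c (x # t))"
  unfolding alternating_def
proof (intro allI)
  fix xs a b ys
  show "c (x # xs @ a # b # ys) = - c (x # xs @ b # a # ys)"
    using alternatingD[OF assms, of "x # xs" a b ys] by simp
qed

lemma alternating_move:
  assumes "alternating c"
  shows "c (xs @ a # ys @ zs) = (if even (length ys) then c (xs @ ys @ a # zs) else - c (xs @ ys @ a # zs))"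
proof (induction ys arbitrary: xs)
  case (Cons y ys)
  have "c (xs @ a # (y # ys) @ zs) = - c ((xs @ [y]) @ a # ys @ zs)"
    using alternatingD[OF assms, of xs a y "ys @ zs"] by simp
  then show ?case using Cons[of "xs @ [y]"] by simp
qed simp

text \<open>Both lists are compared with \<open>xs @ ys @ b # a # zs\<close>; one of the two moves
  passes exactly one element more.\<close>

lemma alternating_swap:
  assumes "alternating c"
  shows "c (xs @ a # ys @ b # zs) = - c (xs @ b # ys @ a # zs)"
  using alternating_move[OF assms, of xs a "ys @ [b]" zs]
    alternating_move[OF assms, of xs b ys "a # zs"] by auto

section \<open>Signs of arbitrary permutations\<close>

lemma permute_list_transpose:
  assumes "i < length s" "j < length s"
  shows "permute_list (Transposition.transpose i j) s = s[i := s ! j, j := s ! i]"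
  using assms by (intro nth_equalityI) (auto simp: permute_list_nth permutes_swap_id permute_list_def
      Transposition.transpose_def nth_list_update)

lemma alternating_transpose:
  assumes c: "alternating c" and "i < j" "j < length s"
  shows "c (s[i := s ! j, j := s ! i]) = - c s"
proof -
  define xs ys zs where "xs = take i s" and "ys = take (j - Suc i) (drop (Suc i) s)"
    and "zs = drop (Suc j) s"
  have "s = xs @ s ! i # drop (Suc i) s" using assms unfolding xs_def by (simp add: id_take_nth_drop)
  moreover have "drop (Suc i) s = ys @ s ! j # zs"
  proof -
    have "drop (Suc i) s = take (j - Suc i) (drop (Suc i) s) @ drop (j - Suc i) (drop (Suc i) s)"
      by (rule append_take_drop_id[symmetric])
    moreover have "drop (j - Suc i) (drop (Suc i) s) = drop j s" using assms by simp
    moreover have "drop j s = s ! j # zs" using assms by (simp add: Cons_nth_drop_Suc zs_def)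
    ultimately show ?thesis by (simp only: ys_def)
  qed
  ultimately have s: "s = xs @ s ! i # ys @ s ! j # zs" by simp
  have l: "length xs = i" "length ys = j - Suc i" using assms by (auto simp: xs_def ys_def)
  have "j = length xs + Suc (length ys)" using \<open>i < j\<close> l by simp
  then have "(xs @ a # ys @ b # zs)[i := b, j := a] = xs @ b # ys @ a # zs" for a b
    using l(1) by (simp add: list_update_append)
  from this[of "s ! i" "s ! j"] have "s[i := s ! j, j := s ! i] = xs @ s ! j # ys @ s ! i # zs"
    unfolding s[symmetric] .
  then show ?thesis using alternating_swap[OF c, of xs "s ! i" ys "s ! j" zs] s by simp
qed

text \<open>Every permutation is a product of transpositions, and each factor flips both the sign of
  the value and the parity.\<close>

lemma alternating_permute:
  fixes c :: "'a list \<Rightarrow> 'g::ab_group_add"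
  assumes c: "alternating c" and p: "p permutes {..<length s}"
  shows "c (permute_list p s) = (if evenperm p then c s else - c s)"
proof -
  \<comment> \<open>The conjunct \<open>permutation p\<close> travels along the induction because
    multiplicativity of the parity needs it.\<close>
  have "permutation p \<and> (\<forall>s. {..<length s} = {..<n} \<longrightarrow> c (permute_list p s) = (if evenperm p then c s else - c s))"
    if "p permutes {..<n}" for p :: "nat \<Rightarrow> nat" and n
    using finite_lessThan[of n] that
  proof (induction rule: permutes_rev_induct)
    case id
    then show ?case by simp
  next
    case (swap a b p)
    let ?t = "Transposition.transpose a b"
    have transp: "c (permute_list ?t t) = - c t" if "length t = n" for t
    proof (cases "a < b")
      case True
      then show ?thesis using alternating_transpose[OF c, of a b t] that swap
        by (simp add: permute_list_transpose)
    next
      case False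
      then have "c (t[b := t ! a, a := t ! b]) = - c t"
        using alternating_transpose[OF c, of b a t] that swap by auto
      then show ?thesis using that swap
        by (simp add: permute_list_transpose list_update_swap)
    qed
    show ?case
    proof (intro conjI allI impI)
      show "permutation (p \<circ> ?t)"
        using swap by (intro permutation_compose permutation_swap_id) auto
      fix s :: "'a list" assume s: "{..<length s} = {..<n}"
      then have n: "length s = n" by simp
      have "evenperm (p \<circ> ?t) \<longleftrightarrow> \<not> evenperm p"
        using swap evenperm_comp[of p ?t] by (simp add: permutation_swap_id evenperm_swap)
      moreover have "permute_list (p \<circ> ?t) s = permute_list ?t (permute_list p s)"
        using n swap by (intro permute_list_compose permutes_swap_id) auto
      ultimately show "c (permute_list (p \<circ> ?t) s) = (if evenperm (p \<circ> ?t) then c s else - c s)"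
        using transp[of "permute_list p s"] n swap by simp
    qed
  qed
  then show ?thesis using p by blast
qed

text \<open>Swaps of neighbours are a special case of the sign rule for permutations and also
  generate it. Finiteness of \<open>X\<close> and of its simplices yields finite support.\<close>

lemma simplicial_chains_eq_alt_chains:
  assumes "finite X" "\<And>\<sigma>. \<sigma> \<in> X \<Longrightarrow> finite \<sigma>"
  shows "simplicial_chains k X = (alt_chains (Suc k) X :: ('a list \<Rightarrow> 'g::ab_group_add) set)"
proof (intro equalityI subsetI)
  fix c :: "'a list \<Rightarrow> 'g" assume c: "c \<in> simplicial_chains k X"
  have "c (xs @ a # b # ys) = - c (xs @ b # a # ys)" for xs a b ys
  proof -
    let ?s = "xs @ b # a # ys" and ?i = "length xs"
    let ?p = "Transposition.transpose ?i (Suc ?i)"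
    have "?p permutes {..<length ?s}" by (rule permutes_swap_id) auto
    then have "c (permute_list ?p ?s) = - c ?s"
      using c by (simp add: simplicial_chains_def evenperm_swap)
    moreover have "permute_list ?p ?s = xs @ a # b # ys"
      by (subst permute_list_transpose) (simp_all add: nth_append list_update_append)
    ultimately show ?thesis by simp
  qed
  then have "alternating c" unfolding alternating_def by blast
  moreover have "distinct s \<and> length s = Suc k \<and> set s \<in> X" if "c s \<noteq> 0" for s
  proof -
    have "s \<in> oriented_simplices k X" using c that unfolding simplicial_chains_def by blast
    then show ?thesis by (auto simp: oriented_simplices_def faces_def distinct_card)
  qed
  ultimately show "c \<in> alt_chains (Suc k) X" unfolding alt_chains_def by blast
next
  fix c :: "'a list \<Rightarrow> 'g" assume c: "c \<in> alt_chains (Suc k) X"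
  have "{s. c s \<noteq> 0} \<subseteq> {s. set s \<subseteq> \<Union>X \<and> length s = Suc k}"
    using c by (auto simp: alt_chains_def)
  then have "finite {s. c s \<noteq> 0}"
    by (rule finite_subset) (use assms in \<open>auto intro: finite_lists_length_eq\<close>)
  moreover have "c s = 0" if "s \<notin> oriented_simplices k X" for s
  proof (rule ccontr)
    assume "c s \<noteq> 0"
    then have "distinct s" "length s = Suc k" "set s \<in> X" using c unfolding alt_chains_def by blast+
    then show False using that by (auto simp: oriented_simplices_def faces_def distinct_card)
  qed
  moreover have "alternating c" using c by (simp add: alt_chains_def)
  ultimately show "c \<in> simplicial_chains k X"
    using alternating_permute[of c] unfolding simplicial_chains_def by blast
qed

text \<open>The chain lives on at least two vertices and so vanishes on one-element lists. Hence
  both boundaries are 0 at the empty list, the only place where they could differ.\<close>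

lemma simplicial_boundary_eq_bd:
  assumes c: "c \<in> alt_chains (Suc (Suc n)) X" and "finite V" "\<Union>X \<subseteq> V"
  shows "simplicial_boundary c = bd V c"
proof
  fix s
  have sub: "{v. c (v # s) \<noteq> 0} \<subseteq> V"
  proof clarify
    fix v assume "c (v # s) \<noteq> 0"
    then have "set (v # s) \<in> X" using c unfolding alt_chains_def by blast
    then show "v \<in> V" using assms(3) by auto
  qed
  show "simplicial_boundary c s = bd V c s"
  proof (cases "s = []")
    case True
    then have "length (v # s) \<noteq> Suc (Suc n)" for v by simp
    then have "c (v # s) = 0" for v using c unfolding alt_chains_def by blast
    then show ?thesis using True by (simp add: simplicial_boundary_def bd_def)
  next
    case False
    then show ?thesis using boundary_eq_sum[OF assms(2) sub] by (simp add: bd_def)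
  qed
qed

section \<open>Operations on alternating chains and the boundary operator\<close>

lemma alt_chains_zero: "(\<lambda>_. 0) \<in> alt_chains n K"
  by (simp add: alt_chains_def alternating_def)

lemma alt_chains_add:
  assumes "a \<in> alt_chains n K" "b \<in> alt_chains n K"
  shows "(\<lambda>s. a s + b s) \<in> alt_chains n K"
proof -
  have "alternating (\<lambda>s. a s + b s)"
    unfolding alternating_def
  proof (intro allI)
    fix xs x y ys
    show "a (xs @ x # y # ys) + b (xs @ x # y # ys) = - (a (xs @ y # x # ys) + b (xs @ y # x # ys))"
      using assms alternatingD[of a xs x y ys] alternatingD[of b xs x y ys] by (simp add: alt_chains_def)
  qed
  moreover have "a s \<noteq> 0 \<or> b s \<noteq> 0" if "a s + b s \<noteq> 0" for s using that by auto
  ultimately show ?thesis using assms unfolding alt_chains_def by blast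
qed

lemma alt_chains_uminus: "a \<in> alt_chains n K \<Longrightarrow> (\<lambda>s. - a s) \<in> alt_chains n K"
  unfolding alt_chains_def alternating_def mem_Collect_eq neg_equal_iff_equal neg_equal_0_iff_equal .

text \<open>The sign rule compares only lists with equal vertex sets, so restricting by a property
  of the vertex set respects it.\<close>

lemma alt_chains_restrict:
  fixes c :: "'a list \<Rightarrow> 'g::ab_group_add"
  assumes "c \<in> alt_chains n K"
  shows "(\<lambda>s. if P (set s) then c s else 0) \<in> alt_chains n {\<sigma> \<in> K. P \<sigma>}"
proof -
  have "alternating (\<lambda>s. if P (set s) then c s else 0)"
    unfolding alternating_def
  proof (intro allI)
    fix xs ys :: "'a list" and a b
    have "set (xs @ a # b # ys) = set (xs @ b # a # ys)" by auto
    then show "(if P (set (xs @ a # b # ys)) then c (xs @ a # b # ys) else 0) =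
       - (if P (set (xs @ b # a # ys)) then c (xs @ b # a # ys) else 0)"
      using assms alternatingD[of c xs a b ys] by (simp add: alt_chains_def)
  qed
  then show ?thesis using assms by (auto simp: alt_chains_def)
qed

lemma alt_chains_mono: "c \<in> alt_chains n K \<Longrightarrow> K \<subseteq> L \<Longrightarrow> c \<in> alt_chains n L"
  by (auto simp: alt_chains_def)

lemma alt_chains_Int: "c \<in> alt_chains n K \<Longrightarrow> c \<in> alt_chains n L \<Longrightarrow> c \<in> alt_chains n (K \<inter> L)"
  by (auto simp: alt_chains_def)

lemma bd_add: "bd V (\<lambda>s. a s + b s) = (\<lambda>s. bd V a s + bd V b s)"
  by (simp add: bd_def sum.distrib fun_eq_iff)

lemma bd_uminus: "bd V (\<lambda>s. - a s) = (\<lambda>s. - bd V a s)"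
  by (simp add: bd_def sum_negf fun_eq_iff)

text \<open>Source and target families are kept apart so that the boundary of a simplex outside a
  complex can still be placed inside it.\<close>

lemma bd_in_alt_chains:
  assumes c: "c \<in> alt_chains (Suc n) K" and K: "\<And>\<sigma> \<tau>. \<sigma> \<in> K \<Longrightarrow> \<tau> \<subseteq> \<sigma> \<Longrightarrow> card \<tau> = n \<Longrightarrow> \<tau> \<in> L"
  shows "bd V c \<in> alt_chains n L"
proof -
  have "alternating (bd V c)"
    unfolding alternating_def
  proof (intro allI)
    fix xs a b ys
    have "alternating c" using c by (simp add: alt_chains_def)
    then have "c (v # xs @ a # b # ys) = - c (v # xs @ b # a # ys)" for v
      using alternatingD[of c "v # xs" a b ys] by simp
    then show "bd V c (xs @ a # b # ys) = - bd V c (xs @ b # a # ys)"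
      by (simp add: bd_def sum_negf)
  qed
  moreover have "distinct s \<and> length s = n \<and> set s \<in> L" if nz: "bd V c s \<noteq> 0" for s
  proof -
    obtain v where "c (v # s) \<noteq> 0" 
      using nz sum.neutral[of V "\<lambda>v. c (v # s)"] unfolding bd_def by blast
    then have "distinct (v # s)" "length (v # s) = Suc n" "set (v # s) \<in> K"
      using c unfolding alt_chains_def by blast+
    then show ?thesis using K[of "set (v # s)" "set s"] by (auto simp: distinct_card)
  qed
  ultimately show ?thesis by (simp add: alt_chains_def)
qed

lemma bd_bd:
  assumes c: "c \<in> alt_chains n K" and V: "finite V"
  shows "bd V (bd V c) = (\<lambda>_. 0)"
proof
  fix s
  show "bd V (bd V c) s = 0"
    unfolding bd_def
  proof (rule sum_antisym_zero[OF V])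
    fix v w
    show "c (w # v # s) = - c (v # w # s)"
      using c alternatingD[of c "[]" w v s] by (simp add: alt_chains_def)
    show "c (v # v # s) = 0" using c by (auto simp: alt_chains_def)
  qed
qed

section \<open>Cones\<close>

text \<open>The join of \<open>v\<close> with \<open>c\<close>: the first \<open>v\<close> in the
  list is deleted and contributes the sign of its position. The recursion collects this sign without
  any order on the vertices.\<close>

fun cone :: "'a \<Rightarrow> ('a list \<Rightarrow> 'g::ab_group_add) \<Rightarrow> 'a list \<Rightarrow> 'g" where
  "cone v c [] = 0"
| "cone v c (x # s) = (if x = v then c s else - cone v (\<lambda>t. c (x # t)) s)"

lemma cone_append:
  "v \<notin> set p \<Longrightarrow> cone v c (p @ v # q) = (if even (length p) then c (p @ q) else - c (p @ q))"
  by (induction p arbitrary: c) auto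

lemma cone_eq_0: "v \<notin> set s \<Longrightarrow> cone v c s = 0"
  by (induction s arbitrary: c) auto

lemma cone_uminus: "cone v (\<lambda>t. - c t) s = - cone v c s"
  by (induction s arbitrary: c) auto

text \<open>The vanishing assumption settles the case \<open>a = b = v\<close>, where the value has
  to equal its own negative.\<close>

lemma alternating_cone:
  assumes "alternating c" and "\<And>s. v \<in> set s \<Longrightarrow> c s = 0"
  shows "alternating (cone v c)"
  unfolding alternating_def
proof (intro allI)
  fix xs a b ys
  show "cone v c (xs @ a # b # ys) = - cone v c (xs @ b # a # ys)"
    using assms
  proof (induction xs arbitrary: c)
    case Nil
    have "c (a # b # t) = - c (b # a # t)" for t using alternatingD[OF Nil(1), of "[]" a b t] by simp
    then have "cone v (\<lambda>t. c (a # b # t)) ys = - cone v (\<lambda>t. c (b # a # t)) ys"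
      by (simp flip: cone_uminus)
    then show ?case using Nil(2) by auto
  next
    case (Cons x xs)
    have "cone v (\<lambda>t. c (x # t)) (xs @ a # b # ys) = - cone v (\<lambda>t. c (x # t)) (xs @ b # a # ys)"
      using Cons.prems by (intro Cons.IH alternating_Cons) auto
    then show ?case using alternatingD[OF Cons.prems(1), of xs a b ys] by simp
  qed
qed

lemma cone_in_alt_chains:
  assumes c: "c \<in> alt_chains n L" and v: "\<And>s. v \<in> set s \<Longrightarrow> c s = 0"
    and K: "\<And>s. c s \<noteq> 0 \<Longrightarrow> insert v (set s) \<in> K"
  shows "cone v c \<in> alt_chains (Suc n) K"
proof -
  have "distinct s \<and> length s = Suc n \<and> set s \<in> K" if s: "cone v c s \<noteq> 0" for s
  proof -
    have "v \<in> set s" using s cone_eq_0[of v s c] by blast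
    then obtain p q where pq: "s = p @ v # q" "v \<notin> set p" by (meson split_list_first)
    then have nz: "c (p @ q) \<noteq> 0" using s by (auto simp: cone_append split: if_splits)
    then have "distinct (p @ q)" "length (p @ q) = n" using c unfolding alt_chains_def by blast+
    moreover have "v \<notin> set (p @ q)" using nz v by blast
    ultimately show ?thesis using pq K[OF nz] by auto
  qed
  then show ?thesis using c v alternating_cone[of c v] by (auto simp: alt_chains_def)
qed

text \<open>Vanishing of reduced homology in degree \<open>n - 1\<close>. The \<open>itself\<close>
  argument fixes the coefficient group, which the other arguments do not mention.\<close>

definition acyclic_at :: "'g::ab_group_add itself \<Rightarrow> 'a set \<Rightarrow> nat \<Rightarrow> 'a set set \<Rightarrow> bool" where
  "acyclic_at _ V n K \<longleftrightarrow>
     (\<forall>c :: 'a list \<Rightarrow> 'g. c \<in> alt_chains n K \<longrightarrow> bd V c = (\<lambda>_. 0) \<longrightarrow> (\<exists>e\<in>alt_chains (Suc n) K. bd V e = c))"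

text \<open>On cycles, coning with apex \<open>v\<close> inverts the boundary. Closure under
  \<open>insert v\<close> is asked for simplices on \<open>n\<close> vertices, those that carry the
  cycle.\<close>

lemma acyclic_at_cone:
  assumes V: "finite V" "v \<in> V"
    and K: "\<And>\<sigma>. \<sigma> \<in> K \<Longrightarrow> card \<sigma> = n \<Longrightarrow> insert v \<sigma> \<in> K"
  shows "acyclic_at TYPE('g::ab_group_add) V n K"
  unfolding acyclic_at_def
proof (intro allI impI)
  fix c :: "'a list \<Rightarrow> 'g" assume c: "c \<in> alt_chains n K" and cyc: "bd V c = (\<lambda>_. 0)"
  have alt: "alternating c" using c by (simp add: alt_chains_def)
  \<comment> \<open>Simplices through \<open>v\<close> are dropped, since they admit no cone from
    \<open>v\<close>. The cycle condition recovers their coefficients below.\<close>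
  define c' where "c' s = (if v \<notin> set s then c s else 0)" for s
  have c': "c' \<in> alt_chains n {\<sigma> \<in> K. v \<notin> \<sigma>}"
    using alt_chains_restrict[OF c, of "\<lambda>\<sigma>. v \<notin> \<sigma>"] unfolding c'_def .
  have e: "cone v c' \<in> alt_chains (Suc n) K"
    by (rule cone_in_alt_chains[OF c'])
      (use c K in \<open>auto simp: c'_def alt_chains_def distinct_card split: if_splits\<close>)
  have "bd V (cone v c') s = c s" for s
  proof (cases "v \<in> set s")
    case False
    have "bd V (cone v c') s = cone v c' (v # s) + (\<Sum>x\<in>V - {v}. cone v c' (x # s))"
      unfolding bd_def using V by (rule sum.remove)
    also have "(\<Sum>x\<in>V - {v}. cone v c' (x # s)) = 0"
      using False by (intro sum.neutral ballI cone_eq_0) auto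
    also have "cone v c' (v # s) = c s" using False by (simp add: c'_def)
    finally show ?thesis by simp
  next
    case True
    then obtain p q where s: "s = p @ v # q" and p: "v \<notin> set p" by (meson split_list_first)
    show ?thesis
    proof (cases "v \<in> set q")
      case True
      have "\<not> distinct (x # s)" "\<not> distinct s" for x using s True by auto
      then have "cone v c' (x # s) = 0" "c s = 0" for x
        using e c unfolding alt_chains_def by blast+
      then show ?thesis by (simp add: bd_def)
    next
      case False
      have "bd V (cone v c') s = cone v c' (v # s) + (\<Sum>x\<in>V - {v}. cone v c' (x # s))"
        unfolding bd_def using V by (rule sum.remove)
      also have "cone v c' (v # s) = 0" using s by (simp add: c'_def)
      also have "(\<Sum>x\<in>V - {v}. cone v c' (x # s))
          = (\<Sum>x\<in>V - {v}. if even (length p) then - c (x # p @ q) else c (x # p @ q))"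
      proof (rule sum.cong)
        fix x assume "x \<in> V - {v}"
        then show "cone v c' (x # s) = (if even (length p) then - c (x # p @ q) else c (x # p @ q))"
          using cone_append[of v "x # p" c' q] p False s by (auto simp: c'_def)
      qed simp
      also have "\<dots> = (if even (length p) then - (\<Sum>x\<in>V - {v}. c (x # p @ q)) else (\<Sum>x\<in>V - {v}. c (x # p @ q)))"
        by (simp add: sum_negf)
      \<comment> \<open>The cycle condition at \<open>p @ q\<close> trades the sum over the other
        vertices for the coefficient of the simplex through \<open>v\<close>.\<close>
      also have "(\<Sum>x\<in>V - {v}. c (x # p @ q)) = - c (v # p @ q)"
      proof -
        have "0 = bd V c (p @ q)" by (simp add: cyc)
        also have "\<dots> = c (v # p @ q) + (\<Sum>x\<in>V - {v}. c (x # p @ q))"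
          unfolding bd_def using V by (rule sum.remove)
        finally show ?thesis by (simp add: eq_neg_iff_add_eq_0 add.commute)
      qed
      also have "c (v # p @ q) = (if even (length p) then c s else - c s)"
        using alternating_move[OF alt, of "[]" v p q] s by simp
      finally show ?thesis by simp
    qed
  qed
  then show "\<exists>e\<in>alt_chains (Suc n) K. bd V e = c" using e by blast
qed

section \<open>Acyclicity of unions of simplices\<close>

text \<open>One step of Mayer-Vietoris on chains: split the cycle, fill the common boundary of the
  pieces inside \<open>K1 \<inter> K2\<close>, then fill each closed-up piece in its own
  part.\<close>

lemma acyclic_at_Un:
  assumes V: "finite V"
    and K1: "\<And>\<sigma> \<tau>. \<sigma> \<in> K1 \<Longrightarrow> \<tau> \<subseteq> \<sigma> \<Longrightarrow> \<tau> \<in> K1" and K2: "\<And>\<sigma> \<tau>. \<sigma> \<in> K2 \<Longrightarrow> \<tau> \<subseteq> \<sigma> \<Longrightarrow> \<tau> \<in> K2"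
    and ac1: "acyclic_at TYPE('g::ab_group_add) V (Suc n) K1" and ac2: "acyclic_at TYPE('g) V (Suc n) K2"
    and ac: "acyclic_at TYPE('g) V n (K1 \<inter> K2)"
  shows "acyclic_at TYPE('g) V (Suc n) (K1 \<union> K2)"
  unfolding acyclic_at_def
proof (intro allI impI)
  fix c :: "'a list \<Rightarrow> 'g" assume c: "c \<in> alt_chains (Suc n) (K1 \<union> K2)" and cyc: "bd V c = (\<lambda>_. 0)"
  define c1 where "c1 s = (if set s \<in> K1 then c s else 0)" for s
  define c2 where "c2 s = (if set s \<notin> K1 then c s else 0)" for s
  have c1: "c1 \<in> alt_chains (Suc n) K1"
    using alt_chains_restrict[OF c, of "\<lambda>\<sigma>. \<sigma> \<in> K1"] unfolding c1_def by (rule alt_chains_mono) auto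
  have c2: "c2 \<in> alt_chains (Suc n) K2"
    using alt_chains_restrict[OF c, of "\<lambda>\<sigma>. \<sigma> \<notin> K1"] unfolding c2_def by (rule alt_chains_mono) auto
  have sum: "c = (\<lambda>s. c1 s + c2 s)" by (auto simp: c1_def c2_def)
  have "bd V c1 s + bd V c2 s = 0" for s
    using cyc unfolding sum bd_add by (rule fun_cong)
  then have eq: "bd V c1 s = - bd V c2 s" for s by (simp add: eq_neg_iff_add_eq_0)
  \<comment> \<open>This boundary lies in \<open>K1\<close> and, being the negative of the boundary
    of \<open>c2\<close>, also in \<open>K2\<close>.\<close>
  have "bd V c1 \<in> alt_chains n K1" by (rule bd_in_alt_chains[OF c1]) (rule K1)
  moreover have "bd V c2 \<in> alt_chains n K2" by (rule bd_in_alt_chains[OF c2]) (rule K2)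
  then have "bd V c1 \<in> alt_chains n K2" using alt_chains_uminus[of "bd V c2"] eq by presburger
  ultimately have "bd V c1 \<in> alt_chains n (K1 \<inter> K2)" by (rule alt_chains_Int)
  then obtain w where w: "w \<in> alt_chains (Suc n) (K1 \<inter> K2)" "bd V w = bd V c1"
    using ac bd_bd[OF c1 V] unfolding acyclic_at_def by blast
  have w1: "w \<in> alt_chains (Suc n) K1" and w2: "w \<in> alt_chains (Suc n) K2"
    using alt_chains_mono[OF w(1)] by auto
  have "bd V (\<lambda>s. c1 s + - w s) = (\<lambda>_. 0)" "bd V (\<lambda>s. c2 s + w s) = (\<lambda>_. 0)"
    unfolding bd_add bd_uminus w by (simp_all add: eq)
  then obtain e1 e2 where e1: "e1 \<in> alt_chains (Suc (Suc n)) K1" "bd V e1 = (\<lambda>s. c1 s + - w s)"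
    and e2: "e2 \<in> alt_chains (Suc (Suc n)) K2" "bd V e2 = (\<lambda>s. c2 s + w s)"
    using ac1 ac2 alt_chains_add[OF c1 alt_chains_uminus[OF w1]] alt_chains_add[OF c2 w2]
    unfolding acyclic_at_def by metis
  have "(\<lambda>s. e1 s + e2 s) \<in> alt_chains (Suc (Suc n)) (K1 \<union> K2)"
    using alt_chains_mono[OF e1(1)] alt_chains_mono[OF e2(1)] by (intro alt_chains_add) auto
  moreover have "bd V (\<lambda>s. e1 s + e2 s) = c"
    unfolding bd_add e1 e2 sum by simp
  ultimately show "\<exists>e\<in>alt_chains (Suc (Suc n)) (K1 \<union> K2). bd V e = c" by blast
qed

text \<open>The complex generated by \<open>F\<close>, with the empty set included as soon as
  \<open>F\<close> is nonempty, as reduced homology requires.\<close>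

definition down :: "'a set set \<Rightarrow> 'a set set" where
  "down F = {\<tau>. \<exists>\<sigma>\<in>F. \<tau> \<subseteq> \<sigma>}"

lemma down_closed: "\<sigma> \<in> down F \<Longrightarrow> \<tau> \<subseteq> \<sigma> \<Longrightarrow> \<tau> \<in> down F"
  by (auto simp: down_def)

lemma acyclic_at_Pow:
  assumes "finite V" "v \<in> V" "v \<in> \<sigma>"
  shows "acyclic_at TYPE('g::ab_group_add) V n (Pow \<sigma>)"
  by (rule acyclic_at_cone[OF assms(1,2)]) (use assms(3) in simp)

text \<open>A single simplex is a cone, so in Mayer-Vietoris the overlap with \<open>down F\<close>
  decides; this overlap is generated by the traces \<open>\<tau> \<inter> \<sigma>\<close>.\<close>

lemma acyclic_at_down_insert:
  assumes "finite V" "acyclic_at TYPE('g::ab_group_add) V (Suc n) (down F)" "v \<in> \<sigma>" "v \<in> V"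
    and "acyclic_at TYPE('g) V n (down ((\<lambda>\<tau>. \<tau> \<inter> \<sigma>) ` F))"
  shows "acyclic_at TYPE('g) V (Suc n) (down (insert \<sigma> F))"
proof -
  have "down (insert \<sigma> F) = down F \<union> Pow \<sigma>" "down F \<inter> Pow \<sigma> = down ((\<lambda>\<tau>. \<tau> \<inter> \<sigma>) ` F)"
    by (auto simp: down_def)
  moreover have "acyclic_at TYPE('g) V (Suc n) (down F \<union> Pow \<sigma>)"
  proof (rule acyclic_at_Un[OF assms(1) _ _ assms(2)])
    show "acyclic_at TYPE('g) V (Suc n) (Pow \<sigma>)" using assms by (intro acyclic_at_Pow)
    show "acyclic_at TYPE('g) V n (down F \<inter> Pow \<sigma>)" using assms(5) calculation by simp
  qed (auto intro: down_closed)
  ultimately show ?thesis by simp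
qed

text \<open>Several sets may have the same trace on \<open>\<sigma>\<close>. Choosing one preimage
  per trace gives a subfamily of \<open>F\<close> of the same size as \<open>T\<close>, to which the
  hypothesis applies.\<close>

lemma restricted_family_meets:
  assumes "finite F" "card T \<le> m" "T \<subseteq> (\<lambda>\<tau>. \<tau> \<inter> \<sigma>) ` F"
    and meet: "\<And>T. T \<subseteq> F \<Longrightarrow> card T \<le> m \<Longrightarrow> s \<inter> \<sigma> \<inter> \<Inter>T \<noteq> {}"
  shows "(s \<inter> \<sigma>) \<inter> \<Inter>T \<noteq> {}"
proof -
  obtain U where U: "U \<subseteq> F" "inj_on (\<lambda>\<tau>. \<tau> \<inter> \<sigma>) U" "T = (\<lambda>\<tau>. \<tau> \<inter> \<sigma>) ` U"
    using assms(3) unfolding subset_image_inj by blast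
  then have "card U \<le> m" using assms(2) by (simp add: card_image)
  with meet[OF U(1)] show ?thesis using U(3) by blast
qed

text \<open>The nerve of such a family contains every \<open>m\<close>-dimensional simplex through \<open>s\<close>, so up to
  that dimension it is a cone with apex \<open>s\<close>.\<close>

lemma acyclic_at_down_special:
  assumes "finite V" "finite F" "s \<in> F" "\<Union>F \<subseteq> V"
    and "\<And>T. T \<subseteq> F \<Longrightarrow> card T \<le> m \<Longrightarrow> s \<inter> \<Inter>T \<noteq> {}"
  shows "acyclic_at TYPE('g::ab_group_add) V m (down F)"
  using assms(2-)
proof (induction m arbitrary: F s)
  case 0
  \<comment> \<open>For the empty subfamily the hypothesis says that \<open>s\<close> has a vertex,
    which then serves as apex.\<close>
  from 0(4)[of "{}"] obtain v where v: "v \<in> s" by auto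
  show ?case
  proof (rule acyclic_at_cone[OF assms(1)])
    show "v \<in> V" using v 0 by blast
    fix \<sigma> assume "\<sigma> \<in> down F" "card \<sigma> = 0"
    moreover have "finite \<sigma>" using \<open>\<sigma> \<in> down F\<close> 0(3) finite_subset[OF _ assms(1)] unfolding down_def by blast
    ultimately show "insert v \<sigma> \<in> down F" using v 0 by (auto simp: down_def)
  qed
next
  case (Suc m)
  \<comment> \<open>The members are added one by one, with \<open>s\<close> present from the
    start.\<close>
  have "acyclic_at TYPE('g) V (Suc m) (down (insert s G))" if "G \<subseteq> F" for G
    using finite_subset[OF that Suc.prems(1)] that
  proof (induction rule: finite_induct)
    case empty
    from Suc.prems(4)[of "{}"] obtain v where "v \<in> s" by auto
    moreover have "down {s} = Pow s" by (auto simp: down_def)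
    ultimately show ?case using acyclic_at_Pow[where 'g = 'g, of V v s] Suc.prems assms(1) by auto
  next
    case (insert \<sigma> G)
    let ?G = "insert s G"
    have G: "?G \<subseteq> F" "\<sigma> \<in> F" using insert Suc.prems by auto
    \<comment> \<open>The new member \<open>\<sigma>\<close> takes one of the \<open>Suc m\<close>
      places. This leaves \<open>m\<close> for \<open>T\<close>, matching the drop in degree on the
      overlap.\<close>
    have meet: "s \<inter> \<sigma> \<inter> \<Inter>T \<noteq> {}" if "T \<subseteq> F" "card T \<le> m" for T
    proof -
      have "card (insert \<sigma> T) \<le> Suc m" using that card_insert_le_m1[of "Suc m" T \<sigma>] by simp
      then show ?thesis using Suc.prems(4)[of "insert \<sigma> T"] that G by (simp add: Int_assoc)
    qed
    from meet[of "{}"] obtain v where v: "v \<in> s" "v \<in> \<sigma>" by auto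
    have "acyclic_at TYPE('g) V m (down ((\<lambda>\<tau>. \<tau> \<inter> \<sigma>) ` ?G))"
    proof (rule Suc.IH[of _ "s \<inter> \<sigma>"])
      fix T assume T: "T \<subseteq> (\<lambda>\<tau>. \<tau> \<inter> \<sigma>) ` ?G" "card T \<le> m"
      show "(s \<inter> \<sigma>) \<inter> \<Inter>T \<noteq> {}"
        by (rule restricted_family_meets[of ?G _ m]) (use T G meet insert in \<open>auto dest: subset_trans\<close>)
    qed (use insert G Suc.prems in auto)
    moreover have "acyclic_at TYPE('g) V (Suc m) (down ?G)" using insert by simp
    moreover have "v \<in> V" using v G Suc.prems by blast
    ultimately have "acyclic_at TYPE('g) V (Suc m) (down (insert \<sigma> ?G))"
      using acyclic_at_down_insert[where 'g = 'g, OF assms(1), of m ?G v \<sigma>] v(2) by blast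
    then show ?case by (simp add: insert_commute)
  qed
  from this[of F] show ?case using Suc.prems by (simp add: insert_absorb)
qed

section \<open>Growing a family along a connected relation\<close>

lemma equivclp_crossing:
  assumes "equivclp R x y" "x \<in> S" "y \<notin> S"
  obtains a b where "a \<in> S" "b \<notin> S" "R a b \<or> R b a"
proof -
  have "y \<in> S" if "\<And>a b. a \<in> S \<Longrightarrow> R a b \<or> R b a \<Longrightarrow> b \<in> S"
    using assms(1,2) by (induction rule: equivclp_induct) (use that in blast)+
  then show ?thesis using that assms(3) by blast
qed

text \<open>A new member \<open>b\<close> related to a present \<open>a\<close> meets the earlier
  part in its traces, among which \<open>a \<inter> b\<close> is the special one for
  \<open>acyclic_at_down_special\<close>. By connectedness the growth stops only at
  \<open>F\<close>.\<close>

lemma acyclic_at_down_connected: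
  assumes "finite V" "finite F" "\<Union>F \<subseteq> V" "{} \<notin> F"
    and conn: "\<And>\<sigma> \<tau>. \<sigma> \<in> F \<Longrightarrow> \<tau> \<in> F \<Longrightarrow> equivclp R \<sigma> \<tau>"
    and R: "\<And>\<sigma> \<tau>. R \<sigma> \<tau> \<Longrightarrow> \<sigma> \<in> F \<and> \<tau> \<in> F"
    and meet: "\<And>\<sigma> \<tau> T. R \<sigma> \<tau> \<Longrightarrow> T \<subseteq> F \<Longrightarrow> card T \<le> k \<Longrightarrow> \<sigma> \<inter> \<tau> \<inter> \<Inter>T \<noteq> {}"
  shows "acyclic_at TYPE('g::ab_group_add) V (Suc k) (down F)"
proof (cases "F = {}")
  case True
  \<comment> \<open>For empty \<open>F\<close> not even the empty set lies in \<open>down F\<close>,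
    so the zero chain is the only one.\<close>
  then have "c = (\<lambda>_. 0)" if "c \<in> alt_chains (Suc k) (down F)" for c :: "_ \<Rightarrow> 'g"
    using that by (auto simp: alt_chains_def down_def)
  moreover have "bd V (\<lambda>_. 0) = (\<lambda>_. 0 :: 'g)" by (simp add: bd_def fun_eq_iff)
  ultimately show ?thesis unfolding acyclic_at_def using alt_chains_zero by blast
next
  case False
  then obtain \<sigma>0 where \<sigma>0: "\<sigma>0 \<in> F" by blast
  \<comment> \<open>A subfamily maximal for \<open>?P\<close> replaces an explicit ordering of the
    members.\<close>
  let ?P = "\<lambda>S. S \<subseteq> F \<and> \<sigma>0 \<in> S \<and> acyclic_at TYPE('g) V (Suc k) (down S)"
  have "\<sigma>0 \<noteq> {}" using \<sigma>0 assms(4) by blast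
  then obtain v where "v \<in> \<sigma>0" by blast
  moreover have "down {\<sigma>0} = Pow \<sigma>0" by (auto simp: down_def)
  ultimately have "?P {\<sigma>0}" using \<sigma>0 assms acyclic_at_Pow[where 'g = 'g, of V v \<sigma>0] by auto
  then have "Collect ?P \<noteq> {}" by blast
  moreover have "finite (Collect ?P)" using assms(2) by simp
  ultimately have "\<exists>S\<in>Collect ?P. \<forall>T\<in>Collect ?P. S \<subseteq> T \<longrightarrow> S = T" by (intro finite_has_maximal)
  then obtain S where "S \<in> Collect ?P" and maximal: "\<forall>T\<in>Collect ?P. S \<subseteq> T \<longrightarrow> S = T" by (rule bexE)
  then have S: "?P S" by simp
  have max: "T = S" if "?P T" "S \<subseteq> T" for T using bspec[OF maximal, of T] that by simp
  have "S = F"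
  proof (rule ccontr)
    assume "S \<noteq> F"
    then obtain \<tau> where "\<tau> \<in> F" "\<tau> \<notin> S" using S by blast
    moreover have "\<sigma>0 \<in> S" using S by blast
    ultimately obtain a b where ab: "a \<in> S" "b \<notin> S" "R a b \<or> R b a"
      using equivclp_crossing[OF conn[OF \<sigma>0]] by blast
    have b: "b \<in> F" using ab R by blast
    have m: "a \<inter> b \<inter> \<Inter>T \<noteq> {}" if "T \<subseteq> F" "card T \<le> k" for T
      using ab(3) meet[OF _ that] by (auto simp: Int_commute)
    have fS: "finite S" using S assms(2) finite_subset by blast
    from m[of "{}"] obtain v where v: "v \<in> b" by auto
    have "acyclic_at TYPE('g) V k (down ((\<lambda>\<tau>. \<tau> \<inter> b) ` S))"
    proof (rule acyclic_at_down_special[of _ _ "a \<inter> b"])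
      show "\<Union>((\<lambda>\<tau>. \<tau> \<inter> b) ` S) \<subseteq> V" using b assms(3) by blast
    next
      fix T assume T: "T \<subseteq> (\<lambda>\<tau>. \<tau> \<inter> b) ` S" "card T \<le> k"
      show "(a \<inter> b) \<inter> \<Inter>T \<noteq> {}"
        by (rule restricted_family_meets[of S _ k]) (use T S m fS in auto)
    qed (use assms(1) ab(1) fS in auto)
    moreover have "v \<in> V" using v b assms(3) by blast
    ultimately have "acyclic_at TYPE('g) V (Suc k) (down (insert b S))"
      using acyclic_at_down_insert[where 'g = 'g, OF assms(1), of k S v b] v S by simp
    then have "insert b S = S" using max[of "insert b S"] S b by auto
    then show False using ab by blast
  qed
  then show ?thesis using S by simp
qed

section \<open>The lower bound\<close>

text \<open>Each member of \<open>T\<close> costs at most \<open>r\<close> elements of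
  \<open>A\<close>. The additive form avoids truncated subtraction.\<close>

lemma card_Int_Inter_ge:
  assumes "finite T" "finite A" "\<And>\<tau>. \<tau> \<in> T \<Longrightarrow> card (A - \<tau>) \<le> r"
  shows "card A \<le> card (A \<inter> \<Inter>T) + r * card T"
  using assms(1,3)
proof (induction rule: finite_induct)
  case (insert \<tau> T)
  have "card (A \<inter> \<Inter>T) \<le> card ((A \<inter> \<Inter>(insert \<tau> T)) \<union> (A - \<tau>))"
    using assms(2) by (intro card_mono) auto
  also have "\<dots> \<le> card (A \<inter> \<Inter>(insert \<tau> T)) + card (A - \<tau>)" by (rule card_Un_le)
  finally have "card (A \<inter> \<Inter>T) \<le> card (A \<inter> \<Inter>(insert \<tau> T)) + r" using insert.prems[of \<tau>] by simp
  moreover have "card A \<le> card (A \<inter> \<Inter>T) + r * card T" using insert by simp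
  ultimately show ?case using insert by simp
qed simp

section \<open>Criteria for trivial and nontrivial homology\<close>

lemma trivial_homologyI:
  assumes X: "abstract_simplicial_complex X"
    and sub: "simplicial_cycles k X \<subseteq> (simplicial_boundaries k X :: ('a list \<Rightarrow> 'g::ab_group_add) set)"
  shows "trivial_group (simplicial_homology k X :: ('a list \<Rightarrow> 'g) set monoid)"
proof -
  let ?G = "simplicial_cycle_group k X :: ('a list \<Rightarrow> 'g) monoid"
  let ?B = "simplicial_boundaries k X :: ('a list \<Rightarrow> 'g) set"
  interpret normal ?B ?G by (rule normal_boundaries[OF X])
  have "?B = carrier ?G" using sub subset by (auto simp: simplicial_cycle_group_def)
  then have "?B #>\<^bsub>?G\<^esub> a = ?B" if "a \<in> carrier ?G" for a
    using that coset_join2[of a ?B] subgroup_axioms by simp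
  then have "carrier (?G Mod ?B) \<subseteq> {?B}"
    unfolding FactGroup_def RCOSETS_def by auto
  moreover have "group (?G Mod ?B)" by (rule factorgroup_is_group)
  moreover have "?B \<in> carrier (?G Mod ?B)"
    using group.subgroup_self[OF \<open>group (?G Mod ?B)\<close>, THEN subgroup.one_closed] by simp
  ultimately show ?thesis unfolding simplicial_homology_def trivial_group_def by auto
qed

lemma nontrivial_homologyI:
  assumes X: "abstract_simplicial_complex X"
    and z: "z \<in> (simplicial_cycles k X :: ('a list \<Rightarrow> 'g::ab_group_add) set)" "z \<notin> simplicial_boundaries k X"
  shows "\<not> trivial_group (simplicial_homology k X :: ('a list \<Rightarrow> 'g) set monoid)"
proof
  let ?G = "simplicial_cycle_group k X :: ('a list \<Rightarrow> 'g) monoid"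
  let ?B = "simplicial_boundaries k X :: ('a list \<Rightarrow> 'g) set"
  assume triv: "trivial_group (simplicial_homology k X :: ('a list \<Rightarrow> 'g) set monoid)"
  interpret normal ?B ?G by (rule normal_boundaries[OF X])
  have zG: "z \<in> carrier ?G" using z by (simp add: simplicial_cycle_group_def)
  then have "?B #>\<^bsub>?G\<^esub> z \<in> carrier (?G Mod ?B)" by (auto simp: FactGroup_def RCOSETS_def)
  then have "?B #>\<^bsub>?G\<^esub> z = ?B"
    using triv unfolding simplicial_homology_def trivial_group_def by (auto simp: FactGroup_def)
  moreover have "z \<in> ?B #>\<^bsub>?G\<^esub> z" using zG by (rule rcos_self) (rule subgroup_axioms)
  ultimately show False using z by simp
qed

lemma vertices_eq_Union:
  assumes "abstract_simplicial_complex X" shows "vertices X = \<Union>X"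
proof (intro equalityI subsetI)
  fix v assume "v \<in> \<Union>X"
  then obtain \<sigma> where "\<sigma> \<in> X" "{v} \<subseteq> \<sigma>" by blast
  then have "{v} \<in> X" using assms unfolding abstract_simplicial_complex_def by blast
  then show "v \<in> vertices X" by (simp add: vertices_def)
qed (auto simp: vertices_def)

text \<open>A ridge has \<open>d\<close> vertices and each facet omits at most \<open>r\<close>
  vertices, so \<open>k\<close> facets together remove at most \<open>r * k < d\<close> of them, and
  some vertex of the ridge lies in all these facets.\<close>

lemma homology_vanishes:
  assumes "1 \<le> k" "k \<le> d" and X: "abstract_simplicial_complex X" "finite X"
    and sc: "strongly_connected_complex d X"
    and n: "card (vertices X) \<le> d + 1 + r" and r: "r * k < d"
  shows "trivial_group (simplicial_homology k X :: ('a list \<Rightarrow> 'g::ab_group_add) set monoid)"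
proof (rule trivial_homologyI[OF X(1)], rule subsetI)
  let ?V = "\<Union>X" and ?F = "faces d X"
  have fin: "\<And>\<sigma>. \<sigma> \<in> X \<Longrightarrow> finite \<sigma>" using X by (simp add: abstract_simplicial_complex_def)
  then have V: "finite ?V" using X by blast
  have F: "finite ?F" "?F \<subseteq> X" using X by (auto simp: faces_def)
  \<comment> \<open>\<open>X\<close> excludes the empty set, whereas \<open>down\<close> includes it
    once there is a facet; with it added on both sides, purity gives equality.\<close>
  have down: "insert {} X = insert {} (down ?F)"
  proof (intro equalityI subsetI)
    fix \<sigma> assume "\<sigma> \<in> insert {} X"
    then show "\<sigma> \<in> insert {} (down ?F)"
      using sc unfolding strongly_connected_complex_def pure_complex_def down_def by blast
  next
    fix \<sigma> assume "\<sigma> \<in> insert {} (down ?F)"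
    then show "\<sigma> \<in> insert {} X"
      using X(1) F(2) unfolding abstract_simplicial_complex_def down_def by blast
  qed
  have chains: "simplicial_chains m X = (alt_chains (Suc m) (down ?F) :: ('a list \<Rightarrow> 'g) set)" for m
  proof -
    \<comment> \<open>These chains live on nonempty lists, so the empty simplex makes no
      difference.\<close>
    have "(alt_chains (Suc m) K :: ('a list \<Rightarrow> 'g) set) = alt_chains (Suc m) (insert {} K)" for K :: "'a set set"
    proof -
      have "distinct s \<and> length s = Suc m \<and> set s \<in> insert {} K
          \<longleftrightarrow> distinct s \<and> length s = Suc m \<and> set s \<in> K" for s by auto
      then show ?thesis by (simp only: alt_chains_def)
    qed
    then show ?thesis using simplicial_chains_eq_alt_chains[OF X(2) fin] down by metis
  qed
  have ac: "acyclic_at TYPE('g) ?V (Suc k) (down ?F)"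
  proof (rule acyclic_at_down_connected[OF V F(1), of "adjacent_facets d X"])
    show "\<Union>?F \<subseteq> ?V" using F by blast
    show "{} \<notin> ?F" by (simp add: faces_def)
    show "equivclp (adjacent_facets d X) \<sigma> \<tau>" if "\<sigma> \<in> ?F" "\<tau> \<in> ?F" for \<sigma> \<tau>
      using sc that by (simp add: strongly_connected_complex_def)
    show "\<sigma> \<in> ?F \<and> \<tau> \<in> ?F" if "adjacent_facets d X \<sigma> \<tau>" for \<sigma> \<tau>
      using that by (simp add: adjacent_facets_def)
  next
    fix \<sigma> \<tau> T assume adj: "adjacent_facets d X \<sigma> \<tau>" and T: "T \<subseteq> ?F" "card T \<le> k"
    obtain \<rho> where \<rho>: "\<rho> \<in> faces (d - 1) X" "\<rho> \<subseteq> \<sigma> \<inter> \<tau>" using adj by (auto simp: adjacent_facets_def)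
    \<comment> \<open>The truncated \<open>d - 1\<close> is harmless because
      \<open>1 \<le> d\<close>.\<close>
    have c\<rho>: "card \<rho> = d" "finite \<rho>" "\<rho> \<subseteq> ?V" using \<rho>(1) assms(1,2) fin by (auto simp: faces_def)
    have "card (\<rho> - \<mu>) \<le> r" if "\<mu> \<in> T" for \<mu>
    proof -
      have \<mu>: "\<mu> \<subseteq> ?V" "card \<mu> = d + 1" using that T by (auto simp: faces_def)
      have "card (\<rho> - \<mu>) \<le> card (?V - \<mu>)" using V c\<rho> by (intro card_mono) auto
      also have "\<dots> \<le> r" using \<mu> n V by (simp add: card_Diff_subset finite_subset vertices_eq_Union[OF X(1)])
      finally show ?thesis .
    qed
    then have "d \<le> card (\<rho> \<inter> \<Inter>T) + r * card T"
      using card_Int_Inter_ge[of T \<rho> r] c\<rho> finite_subset[OF T(1) F(1)] by simp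
    moreover have "r * card T \<le> r * k" using T by simp
    ultimately have "card (\<rho> \<inter> \<Inter>T) > 0" using r by linarith
    then show "\<sigma> \<inter> \<tau> \<inter> \<Inter>T \<noteq> {}" using \<rho>(2) by (auto simp: card_gt_0_iff)
  qed
  fix c :: "'a list \<Rightarrow> 'g" assume c: "c \<in> simplicial_cycles k X"
  then have cc: "c \<in> alt_chains (Suc k) (down ?F)" and cb: "simplicial_boundary c = (\<lambda>_. 0)"
    by (auto simp: simplicial_cycles_def chains)
  have dV: "\<Union>(down ?F) \<subseteq> ?V" using F by (auto simp: down_def)
  \<comment> \<open>\<open>1 \<le> k\<close> excludes chains on single vertices, for which
    \<open>bd\<close> and \<open>simplicial_boundary\<close> can differ.\<close>
  obtain k' where k': "k = Suc k'" using assms(1) by (cases k) auto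
  have "bd ?V c = (\<lambda>_. 0)" using simplicial_boundary_eq_bd[OF cc[unfolded k'] V dV] cb by simp
  then obtain e where e: "e \<in> alt_chains (Suc (Suc k)) (down ?F)" "bd ?V e = c"
    using ac cc unfolding acyclic_at_def by blast
  then show "c \<in> simplicial_boundaries k X"
    unfolding simplicial_boundaries_def chains
    using simplicial_boundary_eq_bd[OF e(1) V dV] by (intro image_eqI[of _ _ e]) simp_all
qed

section \<open>The extremal complexes\<close>

text \<open>Terms cancel along the orbits \<open>{x, h x}\<close>. Fixed points get an assumption of
  their own, since with 2-torsion \<open>f x = - f x\<close> does not force
  \<open>f x = 0\<close>.\<close>

lemma sum_sign_reversing_involution:
  fixes f :: "'b \<Rightarrow> 'g::ab_group_add"
  assumes "finite A"
    and "\<And>x. x \<in> A \<Longrightarrow> h x \<in> A" "\<And>x. x \<in> A \<Longrightarrow> h (h x) = x"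
    and "\<And>x. x \<in> A \<Longrightarrow> f (h x) = - f x" "\<And>x. x \<in> A \<Longrightarrow> h x = x \<Longrightarrow> f x = 0"
  shows "sum f A = 0"
  using assms
proof (induction A rule: finite_psubset_induct)
  case (psubset A)
  show ?case
  proof (cases "A = {}")
    case False
    then obtain x where x: "x \<in> A" by blast
    have hx: "h x \<in> A" "h (h x) = x" using psubset.prems x by auto
    have "sum f (A - {x, h x}) = 0"
    proof (rule psubset.IH)
      show "A - {x, h x} \<subset> A" using x by blast
    next
      fix y assume y: "y \<in> A - {x, h x}"
      then have hy: "h y \<in> A" "h (h y) = y" using psubset.prems by auto
      then show "h y \<in> A - {x, h x}" using y hx by auto
    qed (use psubset.prems in auto)
    moreover have "sum f A = sum f (A - {x, h x}) + sum f {x, h x}"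
      using psubset.hyps(1) x hx by (intro sum.subset_diff) auto
    moreover have "sum f {x, h x} = 0"
      using psubset.prems(3,4)[OF x] by (cases "h x = x") auto
    ultimately show ?thesis by simp
  qed simp
qed

text \<open>This is the oriented simplex \<open>us\<close> with coefficient \<open>g\<close>.
  Iterated coning takes care of the signs of all reorderings.\<close>

lemma simplex_chain_exists:
  fixes g :: "'g::ab_group_add"
  assumes "distinct us"
  shows "\<exists>e\<in>alt_chains (length us) {set us}. e us = g"
  using assms
proof (induction us)
  case Nil
  have "(\<lambda>s. if s = [] then g else 0) \<in> alt_chains (length []) {set []}"
    by (auto simp: alt_chains_def alternating_def)
  then show ?case by (rule rev_bexI) simp
next
  case (Cons u us)
  then obtain e where e: "e \<in> alt_chains (length us) {set us}" "e us = g" by auto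
  have supp: "set s = set us" if "e s \<noteq> 0" for s using e(1) that unfolding alt_chains_def by blast
  have "cone u e \<in> alt_chains (Suc (length us)) {set (u # us)}"
  proof (rule cone_in_alt_chains[OF e(1)])
    show "e s = 0" if "u \<in> set s" for s using supp[of s] that Cons.prems by auto
    show "insert u (set s) \<in> {set (u # us)}" if "e s \<noteq> 0" for s using supp[OF that] by simp
  qed
  then show ?case using e(2) by (intro bexI[of _ "cone u e"]) auto
qed

text \<open>The sum is the coefficient of \<open>[0, \<dots>, k]\<close> in the boundary of the image of \<open>c\<close> under the
  simplicial map \<open>col\<close>. Simplices that use a colour twice cancel in pairs, and no simplex uses
  all \<open>k + 2\<close> colours.\<close>

lemma sum_bd_over_coloured_simplices:
  fixes c :: "'a list \<Rightarrow> 'g::ab_group_add" and col :: "'a \<Rightarrow> nat"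
  assumes c: "c \<in> alt_chains n X" and V: "finite V" "\<And>v. v \<in> V \<Longrightarrow> col v \<le> Suc k"
    and X: "\<And>\<sigma>. \<sigma> \<in> X \<Longrightarrow> \<not> {..Suc k} \<subseteq> col ` \<sigma>"
  shows "(\<Sum>s | set s \<subseteq> V \<and> map col s = [0..<Suc k]. bd V c s) = 0"
proof -
  define S where "S = {s. set s \<subseteq> V \<and> map col s = [0..<Suc k]}"
  have len: "length s = Suc k" if "s \<in> S" for s
  proof -
    have "length (map col s) = length [0..<Suc k]" using that by (simp only: S_def mem_Collect_eq)
    then show ?thesis by simp
  qed
  have "S \<subseteq> {s. set s \<subseteq> V \<and> length s = Suc k}" using len by (auto simp: S_def)
  then have fS: "finite S" by (rule finite_subset) (rule finite_lists_length_eq[OF V(1)])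
  have alt: "alternating c" using c by (simp add: alt_chains_def)
  have nth: "col (s ! j) = j" if "s \<in> S" "j \<le> k" for s j
  proof -
    have "map col s ! j = [0..<Suc k] ! j" using that by (simp add: S_def)
    then show ?thesis using that len[OF that(1)] by (simp del: upt_Suc)
  qed
  \<comment> \<open>If the colour of \<open>v\<close> is at most \<open>k\<close>, \<open>v\<close>
    is exchanged with the entry of the same colour, which stands at position \<open>col v\<close> of
    \<open>s\<close>. Otherwise \<open>v # s\<close> shows all colours and its coefficient is
    0.\<close>
  define h where "h = (\<lambda>(s, v). if col v \<le> k then (s[col v := v], s ! col v) else (s, v))"
  have "(\<Sum>x\<in>S \<times> V. case x of (s, v) \<Rightarrow> c (v # s)) = 0"
  proof (rule sum_sign_reversing_involution[of _ h])
    show "finite (S \<times> V)" using fS V by simp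
  next
    fix x assume "x \<in> S \<times> V"
    then obtain s v where x: "x = (s, v)" "s \<in> S" "v \<in> V" by blast
    have l: "length s = Suc k" by (rule len[OF x(2)])
    have "h x \<in> S \<times> V \<and> h (h x) = x \<and> (case h x of (s, v) \<Rightarrow> c (v # s)) = - (case x of (s, v) \<Rightarrow> c (v # s))
      \<and> (h x = x \<longrightarrow> (case x of (s, v) \<Rightarrow> c (v # s)) = 0)"
    proof (cases "col v \<le> k")
      case True
      let ?j = "col v"
      have j: "?j < length s" using True l by simp
      have hx: "h x = (s[?j := v], s ! ?j)" using True x by (simp add: h_def)
      have col: "col (s ! ?j) = ?j" by (rule nth[OF x(2) True])
      have "map col (s[?j := v]) = (map col s)[?j := map col s ! ?j]"
        using j col by (simp add: map_update)
      then have "map col (s[?j := v]) = map col s" by (simp only: list_update_id)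
      moreover have "set (s[?j := v]) \<subseteq> V"
        using set_update_subset_insert[of s ?j v] x by (auto simp: S_def)
      ultimately have "s[?j := v] \<in> S" using x(2) by (simp add: S_def)
      moreover have "s ! ?j \<in> V" using x(2) nth_mem[OF j] by (auto simp: S_def)
      moreover have "h (h x) = x" unfolding hx using col True j x by (simp add: h_def)
      \<comment> \<open>The exchange is the transposition of positions \<open>0\<close> and
        \<open>Suc ?j\<close> in \<open>v # s\<close>.\<close>
      moreover have "c (s ! ?j # s[?j := v]) = - c (v # s)"
        using alternating_transpose[OF alt, of 0 "Suc ?j" "v # s"] j by simp
      moreover have "c (v # s) = 0" if "s ! ?j = v"
      proof -
        have "\<not> distinct (v # s)" using that nth_mem[OF j] by auto
        then show ?thesis using c unfolding alt_chains_def by blast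
      qed
      ultimately show ?thesis using x hx by auto
    next
      case False
      then have v: "col v = Suc k" using V(2)[OF x(3)] by simp
      have "set (map col s) = set [0..<Suc k]" using x(2) by (simp only: S_def mem_Collect_eq)
      then have "col ` set (v # s) = {..Suc k}" using v by auto
      then have "set (v # s) \<notin> X" using X[of "set (v # s)"] by blast
      then have "c (v # s) = 0" using c unfolding alt_chains_def by blast
      moreover have "h x = x" using False x by (simp add: h_def)
      ultimately show ?thesis using x by simp
    qed
    then show "h x \<in> S \<times> V" "h (h x) = x"
      "(case h x of (s, v) \<Rightarrow> c (v # s)) = - (case x of (s, v) \<Rightarrow> c (v # s))"
      "h x = x \<Longrightarrow> (case x of (s, v) \<Rightarrow> c (v # s)) = 0" by blast+
  qed
  then show ?thesis unfolding bd_def S_def[symmetric] by (simp add: sum.cartesian_product)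
qed

section \<open>The coloured complex\<close>

definition colour :: "nat \<Rightarrow> nat \<Rightarrow> nat \<Rightarrow> nat" where
  "colour k N v = (if v = N then Suc k else v mod Suc k)"

text \<open>The \<open>d\<close>-skeleton of the preimage of the boundary of the
  \<open>(k + 1)\<close>-simplex under the colouring. The last vertex \<open>d + r\<close> alone has
  colour \<open>Suc k\<close>; the others are coloured by residues modulo
  \<open>Suc k\<close>.\<close>

definition tight_complex :: "nat \<Rightarrow> nat \<Rightarrow> nat \<Rightarrow> nat set set" where
  "tight_complex k d r =
     {\<sigma>. \<sigma> \<noteq> {} \<and> \<sigma> \<subseteq> {..d + r} \<and> card \<sigma> \<le> Suc d \<and> \<not> {..Suc k} \<subseteq> colour k (d + r) ` \<sigma>}"

lemma colour_le: "colour k N v \<le> Suc k"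
  using mod_less_divisor[of "Suc k" v] by (simp add: colour_def del: mod_less_divisor)

lemma colour_eq_Suc_iff: "colour k N v = Suc k \<longleftrightarrow> v = N"
  using mod_less_divisor[of "Suc k" v] by (auto simp: colour_def simp del: mod_less_divisor)

text \<open>Apart from \<open>d + r\<close> there are \<open>d + r \<le> r * Suc k\<close> vertices.
  They lie in \<open>r\<close> blocks of \<open>Suc k\<close> consecutive numbers, and each block
  meets a residue class at most once.\<close>

lemma card_colour_class:
  assumes "1 \<le> r" "d \<le> k * r"
  shows "card {v \<in> {..d + r}. colour k (d + r) v = j} \<le> r"
proof (cases "j = Suc k")
  case True
  then have "{v \<in> {..d + r}. colour k (d + r) v = j} = {d + r}" by (auto simp: colour_eq_Suc_iff)
  then show ?thesis using assms by simp
next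
  case False
  let ?C = "{v \<in> {..d + r}. colour k (d + r) v = j}"
  have C: "v < d + r \<and> v mod Suc k = j" if "v \<in> ?C" for v
    using that False by (auto simp: colour_def split: if_splits)
  have "inj_on (\<lambda>v. v div Suc k) ?C"
  proof (rule inj_onI)
    fix v w assume "v \<in> ?C" "w \<in> ?C" "v div Suc k = w div Suc k"
    then show "v = w" using C[of v] C[of w] by (metis div_mult_mod_eq)
  qed
  moreover have "(\<lambda>v. v div Suc k) ` ?C \<subseteq> {..<r}"
  proof (rule image_subsetI)
    fix v assume "v \<in> ?C"
    then have "v < r * Suc k" using C[of v] assms(2) by (simp add: mult.commute)
    then show "v div Suc k \<in> {..<r}" by (simp add: less_mult_imp_div_less)
  qed
  ultimately have "card ?C \<le> card {..<r}" by (intro card_inj_on_le) auto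
  then show ?thesis by simp
qed

lemma tight_complex_simplicial: "abstract_simplicial_complex (tight_complex k d r)"
  unfolding abstract_simplicial_complex_def
proof (intro conjI ballI allI impI)
  fix \<sigma> assume \<sigma>: "\<sigma> \<in> tight_complex k d r"
  then show fin: "finite \<sigma>" "\<sigma> \<noteq> {}" by (auto simp: tight_complex_def intro: finite_subset)
  fix \<tau> assume \<tau>: "\<tau> \<subseteq> \<sigma> \<and> \<tau> \<noteq> {}"
  then have "card \<tau> \<le> card \<sigma>" using fin by (intro card_mono) auto
  moreover have "colour k (d + r) ` \<tau> \<subseteq> colour k (d + r) ` \<sigma>" using \<tau> by blast
  then have "\<not> {..Suc k} \<subseteq> colour k (d + r) ` \<tau>"
    using \<sigma> unfolding tight_complex_def by (metis (no_types, lifting) mem_Collect_eq subset_trans)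
  moreover have "\<tau> \<subseteq> {..d + r}" using \<sigma> \<tau> unfolding tight_complex_def by blast
  ultimately show "\<tau> \<in> tight_complex k d r" using \<sigma> \<tau> by (simp add: tight_complex_def)
qed

lemma finite_tight_complex: "finite (tight_complex k d r)"
  by (rule finite_subset[of _ "Pow {..d + r}"]) (auto simp: tight_complex_def)

lemma vertices_tight_complex: "vertices (tight_complex k d r) = {..d + r}"
proof -
  have "\<not> {..Suc k} \<subseteq> {colour k (d + r) v}" for v
  proof
    assume "{..Suc k} \<subseteq> {colour k (d + r) v}"
    then have "0 = colour k (d + r) v" "Suc k = colour k (d + r) v" by blast+
    then show False by simp
  qed
  then show ?thesis by (auto simp: vertices_def tight_complex_def)
qed

text \<open>Deleting the class of a colour missed by \<open>\<sigma>\<close> leaves at least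
  \<open>d + 1\<close> vertices, enough to extend \<open>\<sigma>\<close> to a facet.\<close>

lemma tight_complex_pure:
  assumes "1 \<le> r" "d \<le> k * r"
  shows "pure_complex d (tight_complex k d r)"
  unfolding pure_complex_def
proof
  fix \<sigma> assume \<sigma>: "\<sigma> \<in> tight_complex k d r"
  then obtain j where j: "j \<le> Suc k" "j \<notin> colour k (d + r) ` \<sigma>" by (auto simp: tight_complex_def)
  let ?B = "{v \<in> {..d + r}. colour k (d + r) v = j}" and ?C = "{..d + r} - {v \<in> {..d + r}. colour k (d + r) v = j}"
  have "card ?C = Suc (d + r) - card ?B" by (subst card_Diff_subset) auto
  then have C: "Suc d \<le> card ?C" using card_colour_class[OF assms, of j] by simp
  have "\<sigma> \<subseteq> ?C" using \<sigma> j by (auto simp: tight_complex_def)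
  moreover have "card \<sigma> \<le> Suc d" using \<sigma> by (simp add: tight_complex_def)
  ultimately obtain \<tau> where \<tau>: "\<sigma> \<subseteq> \<tau>" "\<tau> \<subseteq> ?C" "card \<tau> = Suc d"
    using exists_subset_between[OF _ C, of \<sigma>] by auto
  have "j \<notin> colour k (d + r) ` \<tau>" using \<tau>(2) by auto
  then have "\<not> {..Suc k} \<subseteq> colour k (d + r) ` \<tau>" using j by auto
  moreover have "\<tau> \<noteq> {}" using \<tau>(3) by auto
  ultimately have "\<tau> \<in> tight_complex k d r" using \<tau> by (auto simp: tight_complex_def)
  then show "\<exists>\<tau>\<in>faces d (tight_complex k d r). \<sigma> \<subseteq> \<tau>" using \<tau> by (auto simp: faces_def)
qed

text \<open>Exchanging the largest vertex first removes the vertex \<open>d + r\<close>; after that every exchange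
  stays in the complex, because the colour of \<open>d + r\<close> is missing.\<close>

lemma tight_complex_facet_connected:
  assumes "1 \<le> d" "1 \<le> r" "\<sigma> \<in> faces d (tight_complex k d r)"
  shows "equivclp (adjacent_facets d (tight_complex k d r)) \<sigma> {..d}"
  using assms(3)
proof (induction "card (\<sigma> - {..d})" arbitrary: \<sigma> rule: less_induct)
  case less
  let ?X = "tight_complex k d r"
  have \<sigma>: "\<sigma> \<in> ?X" "card \<sigma> = Suc d" "\<sigma> \<subseteq> {..d + r}" "finite \<sigma>" "\<sigma> \<noteq> {}"
    using less.prems by (auto simp: faces_def tight_complex_def intro: finite_subset)
  show ?case
  proof (cases "\<sigma> = {..d}")
    case False
    define x where "x = Max \<sigma>"
    have x: "x \<in> \<sigma>" using \<sigma> by (simp add: x_def)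
    have "\<not> \<sigma> \<subseteq> {..d}" using False \<sigma>(2) card_subset_eq[of "{..d}" \<sigma>] by auto
    then obtain w where "w \<in> \<sigma>" "d < w" by (meson atMost_iff not_le subsetI)
    then have xd: "d < x" using Max_ge[OF \<sigma>(4)] x_def by (meson less_le_trans)
    have "\<not> {..d} \<subseteq> \<sigma>" using False \<sigma>(2,4) card_subset_eq[of \<sigma> "{..d}"] by auto
    then obtain y where y: "y \<le> d" "y \<notin> \<sigma>" by auto
    define \<rho> where "\<rho> = \<sigma> - {x}"
    define \<sigma>' where "\<sigma>' = insert y \<rho>"
    have \<rho>c: "card \<rho> = d" "finite \<rho>" "y \<notin> \<rho>" using \<sigma> x y by (auto simp: \<rho>_def)
    then have "\<rho> \<noteq> {}" using assms(1) by auto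
    then have \<rho>: "\<rho> \<in> ?X"
      using tight_complex_simplicial[of k d r, unfolded abstract_simplicial_complex_def,
          THEN conjunct2, rule_format, OF \<sigma>(1), of \<rho>] by (simp add: \<rho>_def)
    \<comment> \<open>If \<open>d + r\<close> lay in \<open>\<sigma>\<close>, it was the maximum
      \<open>x\<close> and has been removed; the new vertex \<open>y \<le> d\<close> differs from it
      by \<open>1 \<le> r\<close>.\<close>
    have "v \<noteq> d + r" if "v \<in> \<sigma>'" for v
    proof
      assume v: "v = d + r"
      then have "v \<in> \<rho>" using that y assms(2) by (auto simp: \<sigma>'_def)
      then have "v \<le> x" "v \<noteq> x" "x \<le> d + r" using \<sigma> x by (auto simp: \<rho>_def x_def)
      then show False using v by simp
    qed
    then have "Suc k \<notin> colour k (d + r) ` \<sigma>'" using colour_eq_Suc_iff[of k "d + r"] by force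
    then have "\<not> {..Suc k} \<subseteq> colour k (d + r) ` \<sigma>'" by auto
    moreover have "\<sigma>' \<subseteq> {..d + r}" using \<sigma>(3) y by (auto simp: \<sigma>'_def \<rho>_def)
    moreover have "card \<sigma>' = Suc d" using \<rho>c by (simp add: \<sigma>'_def)
    ultimately have \<sigma>': "\<sigma>' \<in> faces d ?X" by (auto simp: tight_complex_def faces_def \<sigma>'_def)
    have "\<rho> \<in> faces (d - 1) ?X" using \<rho> \<rho>c assms(1) by (simp add: faces_def)
    moreover have "\<rho> \<subseteq> \<sigma>" "\<rho> \<subseteq> \<sigma>'" by (auto simp: \<sigma>'_def \<rho>_def)
    ultimately have "adjacent_facets d ?X \<sigma> \<sigma>'"
      using \<sigma>' less.prems unfolding adjacent_facets_def by blast
    moreover have "card (\<sigma>' - {..d}) < card (\<sigma> - {..d})"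
      using \<sigma> x xd y by (intro psubset_card_mono) (auto simp: \<sigma>'_def \<rho>_def)
    then have "equivclp (adjacent_facets d ?X) \<sigma>' {..d}" using \<sigma>' by (rule less.hyps)
    ultimately show ?thesis by (meson r_into_equivclp equivclp_trans)
  qed simp
qed

lemma tight_complex_strongly_connected:
  assumes "1 \<le> d" "1 \<le> r" "d \<le> k * r"
  shows "strongly_connected_complex d (tight_complex k d r)"
  unfolding strongly_connected_complex_def
proof (intro conjI ballI)
  show "pure_complex d (tight_complex k d r)" using assms by (intro tight_complex_pure)
  fix \<sigma> \<tau> assume "\<sigma> \<in> faces d (tight_complex k d r)" "\<tau> \<in> faces d (tight_complex k d r)"
  then have "equivclp (adjacent_facets d (tight_complex k d r)) \<sigma> {..d}"
    "equivclp (adjacent_facets d (tight_complex k d r)) \<tau> {..d}"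
    using assms tight_complex_facet_connected by auto
  then show "equivclp (adjacent_facets d (tight_complex k d r)) \<sigma> \<tau>"
    by (rule equivclp_trans[OF _ equivclp_sym])
qed

text \<open>The boundary of a rainbow simplex is a cycle of the complex, although the simplex itself
  is no member. Its sum over the lists coloured \<open>[0..<Suc k]\<close> is \<open>g\<close>,
  while every boundary within the complex has sum 0.\<close>

lemma tight_complex_homology:
  fixes g :: "'g::ab_group_add"
  assumes "1 \<le> k" "k \<le> d" "1 \<le> r" "g \<noteq> 0"
  shows "\<not> trivial_group (simplicial_homology k (tight_complex k d r) :: (nat list \<Rightarrow> 'g) set monoid)"
proof -
  let ?X = "tight_complex k d r" and ?V = "{..d + r}" and ?col = "colour k (d + r)"
  define us where "us = (d + r) # [0..<Suc k]"
  have "set [0..<Suc k] = {..k}"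
    by (simp add: atLeastLessThanSuc_atLeastAtMost atLeast0AtMost del: upt_Suc)
  then have us: "distinct us" "length us = Suc (Suc k)" "set us = insert (d + r) {..k}" "set us \<subseteq> ?V"
    using assms unfolding us_def by (simp_all add: atMost_def subset_iff del: upt_Suc)
  obtain e :: "nat list \<Rightarrow> 'g" where e: "e \<in> alt_chains (Suc (Suc k)) {set us}" "e us = g"
    using simplex_chain_exists[OF us(1), of g] us(2) by auto
  have supp: "distinct s \<and> set s = set us" if "e s \<noteq> 0" for s
    using e(1) that unfolding alt_chains_def by blast
  have chains: "simplicial_chains m ?X = (alt_chains (Suc m) ?X :: (nat list \<Rightarrow> 'g) set)" for m
    using tight_complex_simplicial[of k d r] unfolding abstract_simplicial_complex_def
    by (intro simplicial_chains_eq_alt_chains[OF finite_tight_complex]) blast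
  have XV: "\<Union>?X \<subseteq> ?V" by (auto simp: tight_complex_def)
  obtain k' where k': "k = Suc k'" using assms(1) by (cases k) auto
  let ?z = "bd ?V e"
  have z: "?z \<in> alt_chains (Suc k) ?X"
  proof (rule bd_in_alt_chains[OF e(1)])
    fix \<sigma> \<tau> assume "\<sigma> \<in> {set us}" "\<tau> \<subseteq> \<sigma>" and card: "card \<tau> = Suc k"
    then have \<tau>: "\<tau> \<subseteq> ?V" "finite \<tau>" using us(4) by (auto intro: finite_subset)
    \<comment> \<open>A face has \<open>Suc k\<close> vertices, too few for \<open>k + 2\<close>
      colours.\<close>
    have "card (?col ` \<tau>) < card {..Suc k}" using card_image_le[OF \<tau>(2), of ?col] card by simp
    then have "\<not> {..Suc k} \<subseteq> ?col ` \<tau>" using card_mono[of "?col ` \<tau>" "{..Suc k}"] \<tau>(2) by auto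
    then show "\<tau> \<in> ?X" using \<tau> card assms(2) by (auto simp: tight_complex_def)
  qed
  have "?z \<in> alt_chains (Suc (Suc k')) ?X" using z by (simp only: k')
  then have "simplicial_boundary ?z = bd ?V ?z" using XV by (intro simplicial_boundary_eq_bd) auto
  then have "?z \<in> simplicial_cycles k ?X"
    using bd_bd[OF e(1), of ?V] z by (simp add: simplicial_cycles_def chains)
  moreover have "?z \<notin> simplicial_boundaries k ?X"
  proof
    assume "?z \<in> simplicial_boundaries k ?X"
    then obtain c where c: "c \<in> alt_chains (Suc (Suc k)) ?X" "?z = simplicial_boundary c"
      by (auto simp: simplicial_boundaries_def chains)
    then have zc: "?z = bd ?V c" using simplicial_boundary_eq_bd[OF c(1) _ XV] by simp
    let ?S = "{s. set s \<subseteq> ?V \<and> map ?col s = [0..<Suc k]}"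
    have "(\<Sum>s\<in>?S. bd ?V c s) = 0"
      by (rule sum_bd_over_coloured_simplices[OF c(1)]) (auto simp: colour_le tight_complex_def)
    then have "(\<Sum>s\<in>?S. ?z s) = 0" by (simp only: zc)
    moreover have "(\<Sum>s\<in>?S. ?z s) = g"
    proof -
      let ?s = "[0..<Suc k]"
      have col_id: "?col v = v" if "v \<le> k" for v using that assms by (simp add: colour_def)
      have S: "?s \<in> ?S" using assms col_id by (auto intro!: map_idI simp del: upt_Suc)
      have len: "length s = Suc k" if "s \<in> ?S" for s
      proof -
        have "length (map ?col s) = length ?s" using that by (simp only: mem_Collect_eq)
        then show ?thesis by simp
      qed
      have "?S \<subseteq> {s. set s \<subseteq> ?V \<and> length s = Suc k}" using len by blast
      then have fS: "finite ?S" by (rule finite_subset) (rule finite_lists_length_eq, simp)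
      \<comment> \<open>Inside the rainbow simplex the colour sequence determines the list, so only
        \<open>[0..<Suc k]\<close> contributes.\<close>
      have "?z s = 0" if s: "s \<in> ?S" "s \<noteq> ?s" for s
        unfolding bd_def
      proof (intro sum.neutral ballI, rule ccontr)
        fix v assume "e (v # s) \<noteq> 0"
        then have sub: "set s \<subseteq> insert (d + r) {..k}" using supp[of "v # s"] us(3) by auto
        have "?col w = w" if w: "w \<in> set s" for w
        proof -
          have "?col w \<in> set (map ?col s)" using w by simp
          also have "set (map ?col s) = set ?s" using s(1) by (simp only: mem_Collect_eq)
          finally have "w \<noteq> d + r" using colour_eq_Suc_iff[of k "d + r" w] by auto
          then show ?thesis using sub w col_id by auto
        qed
        then have "map ?col s = s" by (rule map_idI)
        then show False using s by simp
      qed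
      then have "(\<Sum>s\<in>?S. ?z s) = (\<Sum>s\<in>{?s}. ?z s)"
        using fS S by (intro sum.mono_neutral_right) auto
      also have "\<dots> = (\<Sum>v\<in>?V. e (v # ?s))" by (simp add: bd_def)
      \<comment> \<open>Only \<open>d + r\<close> completes \<open>[0..<Suc k]\<close> to the vertex
        set of \<open>us\<close>.\<close>
      also have "\<dots> = (\<Sum>v\<in>{d + r}. e (v # ?s))"
      proof (rule sum.mono_neutral_right)
        show "\<forall>v\<in>?V - {d + r}. e (v # ?s) = 0"
        proof (intro ballI, rule ccontr)
          fix v assume v: "v \<in> ?V - {d + r}" "e (v # ?s) \<noteq> 0"
          then have "d + r \<in> set (v # ?s)" using supp us(3) by blast
          then show False using v assms by auto
        qed
      qed auto
      also have "\<dots> = g" using e(2) by (simp add: us_def)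
      finally show ?thesis .
    qed
    ultimately show False using assms(4) by simp
  qed
  ultimately show ?thesis by (rule nontrivial_homologyI[OF tight_complex_simplicial])
qed

text \<open>Tightness asks for a nonzero coefficient because over the trivial group all homology
  vanishes.\<close>

theorem theorem2:
  fixes k d :: nat
  assumes "1 \<le> k" and "k \<le> d"
  shows "int d + 1 + \<lceil>real d / real k\<rceil> = \<lceil>real d * (real k + 1) / real k + 1\<rceil> \<and>
    (\<forall>X :: 'a set set.
       abstract_simplicial_complex X \<and> finite X \<and> strongly_connected_complex d X \<and>
       \<not> trivial_group (simplicial_homology k X :: ('a list \<Rightarrow> 'g::ab_group_add) set monoid) \<longrightarrow>
       int (card (vertices X)) \<ge> int d + 1 + \<lceil>real d / real k\<rceil>) \<and>
    ((\<exists>g :: 'g. g \<noteq> 0) \<longrightarrow>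
     (\<exists>X :: nat set set.
       abstract_simplicial_complex X \<and> finite X \<and> strongly_connected_complex d X \<and>
       \<not> trivial_group (simplicial_homology k X :: (nat list \<Rightarrow> 'g) set monoid) \<and>
       int (card (vertices X)) = int d + 1 + \<lceil>real d / real k\<rceil>))"
proof -
  define r where "r = nat \<lceil>real d / real k\<rceil>"
  have "0 < real d / real k" using assms by simp
  then have "0 < \<lceil>real d / real k\<rceil>" by (simp only: zero_less_ceiling)
  then have r: "\<lceil>real d / real k\<rceil> = int r" "1 \<le> r" unfolding r_def by linarith+
  have "real d / real k \<le> real r" using r(1) by linarith
  then have "real d \<le> real (k * r)" using assms by (simp add: field_simps)
  then have dkr: "d \<le> k * r" by (simp only: of_nat_le_iff)
  \<comment> \<open>The ceiling exceeds \<open>d / k\<close> by less than 1, so with one vertex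
    fewer, that is with \<open>r - 1\<close> in place of \<open>r\<close>, the vanishing result
    applies.\<close>
  have "real (r - 1) < real d / real k" using r by linarith
  then have "real ((r - 1) * k) < real d" using assms by (simp add: field_simps)
  then have lt: "(r - 1) * k < d" by (simp only: of_nat_less_iff)
  have "real d * (real k + 1) / real k + 1 = real d / real k + real_of_int (int d + 1)"
    using assms by (simp add: field_simps)
  then have 1: "int d + 1 + \<lceil>real d / real k\<rceil> = \<lceil>real d * (real k + 1) / real k + 1\<rceil>"
    by (simp only: ceiling_add_of_int)
  have 2: "int (card (vertices X)) \<ge> int d + 1 + \<lceil>real d / real k\<rceil>"
    if "abstract_simplicial_complex X" "finite X" "strongly_connected_complex d X"
      "\<not> trivial_group (simplicial_homology k X :: ('a list \<Rightarrow> 'g) set monoid)" for X :: "'a set set"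
  proof (rule ccontr)
    assume "\<not> ?thesis"
    then have "card (vertices X) \<le> d + 1 + (r - 1)" using r by linarith
    then show False using homology_vanishes[OF assms that(1-3) _ lt] that(4) by blast
  qed
  have 3: "\<exists>X :: nat set set.
       abstract_simplicial_complex X \<and> finite X \<and> strongly_connected_complex d X \<and>
       \<not> trivial_group (simplicial_homology k X :: (nat list \<Rightarrow> 'g) set monoid) \<and>
       int (card (vertices X)) = int d + 1 + \<lceil>real d / real k\<rceil>" if "g \<noteq> 0" for g :: 'g
  proof (intro exI conjI)
    show "strongly_connected_complex d (tight_complex k d r)"
      using assms r dkr by (intro tight_complex_strongly_connected) auto
    show "\<not> trivial_group (simplicial_homology k (tight_complex k d r) :: (nat list \<Rightarrow> 'g) set monoid)"
      using assms r that by (intro tight_complex_homology)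
    show "int (card (vertices (tight_complex k d r))) = int d + 1 + \<lceil>real d / real k\<rceil>"
      by (simp add: vertices_tight_complex r)
  qed (rule tight_complex_simplicial finite_tight_complex)+
  show ?thesis using 1 2 3 by blast
qed

end
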